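(* For $k\ge 1$, we have $$ f(n,k,\lambda)\le (2n-2)\left\lceil\frac{k+1}{3}\right\rceil. $$ Moreover, if $\lambda=o(n)$, then $$ f(n,k,\lambda)\le\left(\frac32+o(1)\right)n\left\lceil\frac{k+1}{3}\right\rceil. $$
   Context: Here $n$ is a positive integer, $k$ and $\lambda$ are non-negative integers, and $[n]=\{1,\dots,n\}$. A family (set of distinct subsets) $\mathcal{F}\subset 2^{[n]}$ is called $k$-almost $\lambda$-Fisher if for every $F\in\mathcal{F}$ there are at most $k$ other sets $F'\in\mathcal{F}\setminus\{F\}$ with $|F\cap F'|\neq\lambda$. Define $f(n,k,\lambda)=\max\{|\mathcal{F}| : \mathcal{F}\subset 2^{[n]} \text{ is a } k\text{-almost } \lambda\text{-Fisher family}\}$. The notations $o(n)$ and $o(1)$ refer to $n\to\infty$, with $\lambda=\lambda(n)$ allowed to depend on $n$.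
   Formalization: The first bound is stated for n ≥ 5, since it fails for each n = 1,…,4 (for n=4, k=2, λ=0 the family ∅,{1},{2},{1,2},{3},{4},{3,4} has 7 > 6 sets); in the second bound k is fixed, so the o(1) may depend on k. *)

theory Defs
  imports Complex_Main "HOL-Library.Landau_Symbols"
begin

definition almost_fisher :: "nat \<Rightarrow> nat \<Rightarrow> nat \<Rightarrow> nat set set \<Rightarrow> bool" where
  "almost_fisher n k l \<F> \<longleftrightarrow>
     \<F> \<subseteq> Pow {1..n} \<and>
     (\<forall>F\<in>\<F>. card {F' \<in> \<F> - {F}. card (F \<inter> F') \<noteq> l} \<le> k)"

definition max_almost_fisher :: "nat \<Rightarrow> nat \<Rightarrow> nat \<Rightarrow> nat" where
  "max_almost_fisher n k l = Max {card \<F> |\<F>. almost_fisher n k l \<F>}"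

lemma finite_card_almost_fisher: "finite {card \<F> |\<F>. almost_fisher n k l \<F>}"
proof -
  have "{card \<F> |\<F>. almost_fisher n k l \<F>} \<subseteq> card ` Pow (Pow {1..n})"
    by (auto simp: almost_fisher_def)
  thus ?thesis
    by (rule finite_subset) simp
qed

lemma max_almost_fisher_attained:
  "\<exists>\<F>. almost_fisher n k l \<F> \<and> card \<F> = max_almost_fisher n k l"
proof -
  have "almost_fisher n k l {}"
    by (simp add: almost_fisher_def)
  hence "{card \<F> |\<F>. almost_fisher n k l \<F>} \<noteq> {}"
    by blast
  from Max_in[OF finite_card_almost_fisher this] show ?thesis
    unfolding max_almost_fisher_def by auto
qed

lemma card_le_max_almost_fisher:
  "almost_fisher n k l \<F> \<Longrightarrow> card \<F> \<le> max_almost_fisher n k l"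
  unfolding max_almost_fisher_def by (rule Max_ge[OF finite_card_almost_fisher]) blast

text \<open>The bound (2 n - 2) \<lceil>(k + 1) / 3\<rceil> equals 6 for n = 4 and k = 2, so the next lemma shows
  that it is violated there. It is also violated for n = 1, n = 2 and n = 3 (take k = 2), so n \<ge> 5
  is the largest range of n in which the bound can hold for all positive k and all l.\<close>

lemma max_almost_fisher_4_2_0: "max_almost_fisher 4 2 0 \<ge> 7"
proof -
  define \<F> :: "nat set set" where "\<F> = {{}, {1}, {2}, {1,2}, {3}, {4}, {3,4}}"
  have ne: "{1} \<noteq> {2::nat}" "{1,2} \<noteq> {1::nat}" "{1,2} \<noteq> {2::nat}"
    "{3,4} \<noteq> {3::nat}" "{3,4} \<noteq> {4::nat}" "{1,2} \<noteq> {3,4::nat}"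
    "{1,2} \<noteq> {3::nat}" "{1,2} \<noteq> {4::nat}" "{1} \<noteq> {3,4::nat}" "{2} \<noteq> {3,4::nat}"
    by (simp_all add: set_eq_iff) presburger+
  have c: "card \<F> = 7"
    unfolding \<F>_def using ne by (simp add: card_insert_if)
  have bad: "card {F' \<in> \<F> - {F}. card (F \<inter> F') \<noteq> 0} \<le> 2"
    if sub: "{F' \<in> \<F> - {F}. card (F \<inter> F') \<noteq> 0} \<subseteq> {X, Y}" for F X Y :: "nat set"
    using card_mono[OF _ sub] card_insert_le_m1[of 2 "{Y}" X] by (simp add: card_insert_if split: if_splits)
  have "card {F' \<in> \<F> - {F}. card (F \<inter> F') \<noteq> 0} \<le> 2" if "F \<in> \<F>" for F
  proof -
    consider "F = {}" | "F = {1}" | "F = {2}" | "F = {1,2}" | "F = {3}" | "F = {4}" | "F = {3,4}"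
      using \<open>F \<in> \<F>\<close> unfolding \<F>_def by blast
    thus ?thesis
    proof cases
      case 1 thus ?thesis by simp
    next
      case 2 show ?thesis by (rule bad[of _ "{2}" "{1,2}"]) (auto simp: 2 \<F>_def)
    next
      case 3 show ?thesis by (rule bad[of _ "{1}" "{1,2}"]) (auto simp: 3 \<F>_def)
    next
      case 4 show ?thesis by (rule bad[of _ "{1}" "{2}"]) (auto simp: 4 \<F>_def)
    next
      case 5 show ?thesis by (rule bad[of _ "{4}" "{3,4}"]) (auto simp: 5 \<F>_def)
    next
      case 6 show ?thesis by (rule bad[of _ "{3}" "{3,4}"]) (auto simp: 6 \<F>_def)
    next
      case 7 show ?thesis by (rule bad[of _ "{3}" "{4}"]) (auto simp: 7 \<F>_def)
    qed
  qed
  moreover have "\<F> \<subseteq> Pow {1..4}"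
    unfolding \<F>_def by auto
  ultimately have "almost_fisher 4 2 0 \<F>"
    unfolding almost_fisher_def by blast
  from card_le_max_almost_fisher[OF this] show ?thesis
    by (simp add: c)
qed

end

theory Submission
  imports Defs "HOL-Analysis.Convex"
begin

text \<open>A graph of maximum degree at most \<open>k\<close> splits into \<open>\<lceil>(k + 1) / 3\<rceil>\<close> parts that induce maximum
  degree at most 2 (Lovasz, \<open>exists_balanced_colouring\<close>). Applied to the graph of the pairs of members
  whose intersection does not have \<open>l\<close> elements, this reduces both bounds to the case \<open>k = 2\<close>, in
  which the components of the graph are paths and cycles.

  Let \<open>A\<close> be the Gram matrix of the indicator vectors minus \<open>l\<close> times the all-ones matrix; it is block
  diagonal with respect to the components. A vector \<open>x\<close> in the kernel of \<open>A\<close> satisfies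
  \<open>\<parallel>combo x\<parallel>\<^sup>2 = l * (total x)\<^sup>2\<close>, where \<open>total x\<close> is its coefficient sum and \<open>combo x\<close> the corresponding
  combination of indicator vectors. Therefore kernel vectors of sum zero are affine dependences among
  the members, and all kernel vectors of sum one represent the same vector \<open>w\<close>, whose inner product
  with every member, and with itself, is \<open>l\<close>. Conversely, a vector \<open>x\<close> with \<open>combo x = 0\<close> and
  \<open>total x = 0\<close> lies in the kernel. So the number of members is at most \<open>n + 1\<close> plus the number of
  equations that determine the kernel vectors of sum zero.

  Affine dependences among at most five vertices of a cube are scarce (\<open>affine_dep_card_le_3\<close>,
  \<open>affine_dep_card_4\<close>, \<open>affine_dep_card_5\<close>), and in any component a kernel vector is determined by its
  values on one edge (\<open>kernel_zero_of_edge\<close>). If all kernel vectors have sum zero, at most a third of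
  the coordinates is needed and the number of members is at most \<open>3 / 2 * (n + 1)\<close>. In general only the
  number of special components, those with at most five members and a kernel vector of nonzero sum,
  has to be added (\<open>card_Fam_le_special\<close>).

  For the first bound, if some member has fewer than \<open>l\<close> elements, then there are at most three
  members. If \<open>l = 0\<close> or some isolated member has exactly \<open>l\<close> elements, then all members contain a
  common set of \<open>l\<close> elements, and a direct count gives \<open>3 / 2 * n + 1\<close> (\<open>core_bound\<close>). Suppose that none
  of this holds and that \<open>w\<close> exists. Then \<open>w\<close> yields a linear relation that saves one coordinate,
  another one is saved because kernel vectors of nonzero sum are excluded, and half of the members
  determine a kernel vector; this gives \<open>2 * n - 2\<close> (\<open>card_Fam_le_of_unit_kernel\<close>).

  For the second bound, let \<open>l\<close> be small compared with \<open>n\<close>. Only boundedly many members are large. If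
  more than a small proportion of \<open>n\<close> special components have only small members, then Bessel's
  inequality forces \<open>w\<close> to be a 0/1 vector (\<open>core_of_many_special\<close>), so all members contain a common
  set of \<open>l\<close> elements and the direct count applies again. Otherwise the number of special components is
  negligible.\<close>

section \<open>Linear algebra over a finite index set\<close>

text \<open>A homogeneous linear system with more unknowns than equations has a nontrivial solution. An
  equation is given by its coefficient vector. To remove the equation \<open>e\<close>, take a solution \<open>x\<close> of
  the other ones and a coordinate \<open>p\<close> with \<open>x p \<noteq> 0\<close>, then a second solution \<open>y\<close> with \<open>y p = 0\<close>, and
  combine the two.\<close>
lemma card_le_card_functionals:
  fixes E :: "('a \<Rightarrow> real) set"
  assumes "finite E" "finite V"
    and "\<And>x. (\<And>e. e \<in> E \<Longrightarrow> (\<Sum>v\<in>V. e v * x v) = 0) \<Longrightarrow> (\<forall>v\<in>V. x v = 0)"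
  shows "card V \<le> card E"
proof -
  have "\<exists>x. (\<exists>v\<in>V. x v \<noteq> 0) \<and> (\<forall>e\<in>E. (\<Sum>v\<in>V. e v * x v) = 0)"
    if "finite V" "card E < card V" for V :: "'a set"
    using \<open>finite E\<close> that
  proof (induction E arbitrary: V rule: finite_induct)
    case empty
    then have "V \<noteq> {}" by auto
    then show ?case by (intro exI[of _ "\<lambda>_. 1"]) auto
  next
    case (insert e E)
    have solve: "\<exists>x. x p = 0 \<and> (\<exists>v\<in>V. x v \<noteq> 0) \<and> (\<forall>e\<in>E. (\<Sum>v\<in>V. e v * x v) = 0)"
      if p: "p \<in> V" for p
    proof -
      from insert p have "card E < card (V - {p})" by simp
      with insert.IH[of "V - {p}"] insert.prems obtain x where
        x: "\<exists>v\<in>V - {p}. x v \<noteq> 0" "\<forall>e\<in>E. (\<Sum>v\<in>V - {p}. e v * x v) = 0" by auto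
      have "(\<Sum>v\<in>V. e v * (x(p := 0)) v) = (\<Sum>v\<in>V - {p}. e v * x v)" for e :: "'a \<Rightarrow> real"
        using insert.prems p by (subst sum.remove[of _ p]) (auto intro!: sum.cong)
      with x show ?thesis by (intro exI[of _ "x(p := 0)"]) auto
    qed
    from insert.prems have "V \<noteq> {}" by auto
    then obtain x where x: "\<exists>v\<in>V. x v \<noteq> 0" "\<forall>e\<in>E. (\<Sum>v\<in>V. e v * x v) = 0"
      using solve by blast
    then obtain p where p: "p \<in> V" "x p \<noteq> 0" by blast
    obtain y where y: "y p = 0" "\<exists>v\<in>V. y v \<noteq> 0" "\<forall>e\<in>E. (\<Sum>v\<in>V. e v * y v) = 0"
      using solve[OF p(1)] by blast
    define ex where "ex = (\<Sum>v\<in>V. e v * x v)"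
    define ey where "ey = (\<Sum>v\<in>V. e v * y v)"
    show ?case
    proof (cases "ey = 0")
      case True
      with y show ?thesis unfolding ey_def by (intro exI[of _ y]) auto
    next
      case False
      define z where "z = (\<lambda>v. ey * x v - ex * y v)"
      have lin: "(\<Sum>v\<in>V. f v * z v) = ey * (\<Sum>v\<in>V. f v * x v) - ex * (\<Sum>v\<in>V. f v * y v)" for f
        unfolding z_def sum_distrib_left sum_subtractf[symmetric]
        by (rule sum.cong) (auto simp: algebra_simps)
      have "z p \<noteq> 0" using False p y by (simp add: z_def)
      moreover have "\<forall>f\<in>insert e E. (\<Sum>v\<in>V. f v * z v) = 0"
        using x y by (auto simp: lin ex_def[symmetric] ey_def[symmetric])
      ultimately show ?thesis using p by blast
    qed
  qed
  then show ?thesis using assms by (meson not_less)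
qed

text \<open>Bessel's inequality for the unit vector at the coordinate \<open>p\<close>, with the norms of the
  pairwise orthogonal vectors \<open>u C\<close> replaced by a common upper bound.\<close>
lemma orthogonal_coordinate_bound:
  fixes u :: "'c \<Rightarrow> 'y \<Rightarrow> real"
  assumes "finite T" "finite Y" "p \<in> Y" "B \<ge> 0"
    and orth: "\<And>C D. C \<in> T \<Longrightarrow> D \<in> T \<Longrightarrow> C \<noteq> D \<Longrightarrow> (\<Sum>y\<in>Y. u C y * u D y) = 0"
    and norm: "\<And>C. C \<in> T \<Longrightarrow> (\<Sum>y\<in>Y. u C y * u C y) \<le> B"
  shows "(\<Sum>C\<in>T. (u C p)\<^sup>2) \<le> B"
proof -
  define q where "q = (\<Sum>C\<in>T. (u C p)\<^sup>2)"
  define v where "v = (\<lambda>y. \<Sum>C\<in>T. u C p * u C y)"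
  have q0: "q \<ge> 0" unfolding q_def by (simp add: sum_nonneg)
  have "v p = q" by (simp add: v_def q_def power2_eq_square)
  then have "q\<^sup>2 \<le> (\<Sum>y\<in>Y. (v y)\<^sup>2)"
    using member_le_sum[of p Y "\<lambda>y. (v y)\<^sup>2"] assms by simp
  also have "\<dots> = (\<Sum>y\<in>Y. \<Sum>C\<in>T. \<Sum>D\<in>T. u C p * u D p * (u C y * u D y))"
    unfolding v_def power2_eq_square sum_product by (intro sum.cong refl) (simp add: algebra_simps)
  also have "\<dots> = (\<Sum>C\<in>T. \<Sum>y\<in>Y. \<Sum>D\<in>T. u C p * u D p * (u C y * u D y))"
    by (rule sum.swap)
  also have "\<dots> = (\<Sum>C\<in>T. \<Sum>D\<in>T. u C p * u D p * (\<Sum>y\<in>Y. u C y * u D y))"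
    by (intro sum.cong refl, subst sum.swap) (simp add: sum_distrib_left)
  also have "\<dots> = (\<Sum>C\<in>T. \<Sum>D\<in>T. if D = C then (u C p)\<^sup>2 * (\<Sum>y\<in>Y. u C y * u C y) else 0)"
    by (intro sum.cong refl) (auto simp: orth power2_eq_square)
  also have "\<dots> = (\<Sum>C\<in>T. (u C p)\<^sup>2 * (\<Sum>y\<in>Y. u C y * u C y))"
    using assms(1) by simp
  also have "\<dots> \<le> (\<Sum>C\<in>T. (u C p)\<^sup>2 * B)"
    by (intro sum_mono mult_left_mono norm) auto
  also have "\<dots> = q * B" by (simp add: q_def sum_distrib_right)
  finally have "q * q \<le> q * B" by (simp add: power2_eq_square)
  then show ?thesis using q0 assms(4) unfolding q_def[symmetric]
    by (cases "q = 0") auto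
qed

section \<open>Affine dependences among vertices of a cube\<close>

text \<open>The function \<open>x\<close> gives the coefficients of an affine dependence among the indicator vectors of
  the sets in \<open>C\<close>; the coefficients are allowed to vanish.\<close>
definition affine_dep :: "'a set set \<Rightarrow> ('a set \<Rightarrow> real) \<Rightarrow> bool" where
  "affine_dep C x \<longleftrightarrow>
     (\<forall>y. (\<Sum>G\<in>C. of_bool (y \<in> G) * x G) = 0) \<and> (\<Sum>G\<in>C. x G) = 0"

lemma of_bool_mult_eq: "of_bool P * (a :: real) = (if P then a else 0)"
  by simp

text \<open>No three vertices of a cube are collinear.\<close>
lemma affine_dep_three:
  fixes a b c :: real
  assumes "A \<noteq> B" "A \<noteq> C" "B \<noteq> C" "a + b + c = 0"
    and "\<And>y. of_bool (y \<in> A) * a + of_bool (y \<in> B) * b + of_bool (y \<in> C) * c = 0"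
  shows "a = 0"
proof -
  have sep: "\<exists>y. (y \<in> X) \<noteq> (y \<in> Y)" if "X \<noteq> Y" for X Y :: "'a set" using that by blast
  obtain y1 where y1: "(y1 \<in> A) \<noteq> (y1 \<in> B)" using sep assms by blast
  obtain y2 where y2: "(y2 \<in> A) \<noteq> (y2 \<in> C)" using sep assms by blast
  obtain y3 where y3: "(y3 \<in> B) \<noteq> (y3 \<in> C)" using sep assms by blast
  have 1: "a = 0 \<or> b = 0"
    using y1 assms(4) assms(5)[of y1] unfolding of_bool_mult_eq by (smt (verit))
  have 2: "a = 0 \<or> c = 0"
    using y2 assms(4) assms(5)[of y2] unfolding of_bool_mult_eq by (smt (verit))
  have 3: "b = 0 \<or> c = 0"
    using y3 assms(4) assms(5)[of y3] unfolding of_bool_mult_eq by (smt (verit))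
  show ?thesis using 1 2 3 assms(4) by (smt (verit))
qed

text \<open>Four coplanar vertices of a cube form a parallelogram, so the coefficients of an affine
  dependence are equal up to sign.\<close>
lemma affine_dep_four:
  fixes a b c d :: real
  assumes "A \<noteq> B" "A \<noteq> C" "A \<noteq> D" "B \<noteq> C" "B \<noteq> D" "C \<noteq> D" "a + b + c + d = 0"
    and "\<And>y. of_bool (y \<in> A) * a + of_bool (y \<in> B) * b + of_bool (y \<in> C) * c
              + of_bool (y \<in> D) * d = 0"
  shows "\<bar>a\<bar> = \<bar>b\<bar>"
proof (cases "a = 0 \<or> b = 0 \<or> c = 0 \<or> d = 0")
  case True
  have "a = 0 \<Longrightarrow> b = 0" using affine_dep_three[of B C D b c d] assms by simp
  moreover have "b = 0 \<Longrightarrow> a = 0" using affine_dep_three[of A C D a c d] assms by simp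
  moreover have "c = 0 \<Longrightarrow> a = 0" using affine_dep_three[of A B D a b d] assms by simp
  moreover have "d = 0 \<Longrightarrow> a = 0" using affine_dep_three[of A B C a b c] assms by simp
  ultimately show ?thesis using True by auto
next
  case False
  have sep: "\<exists>y. (y \<in> X) \<noteq> (y \<in> Y)" if "X \<noteq> Y" for X Y :: "'a set" using that by blast
  \<comment> \<open>An element that separates two of the sets exhibits a zero subsum of two coefficients,
    because no single coefficient vanishes.\<close>
  have key: "a + c = 0 \<or> a + d = 0"
  proof -
    obtain y where y: "(y \<in> A) \<noteq> (y \<in> B)" using sep assms by blast
    show ?thesis using y assms(7) assms(8)[of y] False unfolding of_bool_mult_eq by (smt (verit))
  qed
  have key2: "a + b = 0 \<or> a + d = 0"
  proof -
    obtain y where y: "(y \<in> A) \<noteq> (y \<in> C)" using sep assms by blast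
    show ?thesis using y assms(7) assms(8)[of y] False unfolding of_bool_mult_eq by (smt (verit))
  qed
  have key3: "a + b = 0 \<or> a + c = 0"
  proof -
    obtain y where y: "(y \<in> A) \<noteq> (y \<in> D)" using sep assms by blast
    show ?thesis using y assms(7) assms(8)[of y] False unfolding of_bool_mult_eq by (smt (verit))
  qed
  show ?thesis using key key2 key3 assms(7) by linarith
qed

lemma affine_dep_card_le_3:
  assumes "finite C" "card C \<le> 3" "affine_dep C x" "F \<in> C"
  shows "x F = 0"
proof -
  have eq: "x F + (\<Sum>G\<in>C - {F}. x G) = 0"
    "\<And>y. of_bool (y \<in> F) * x F + (\<Sum>G\<in>C - {F}. of_bool (y \<in> G) * x G) = 0"
    using assms(3) unfolding affine_dep_def sum.remove[OF assms(1,4)] by blast+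
  have "card (C - {F}) \<le> 2" using assms by simp
  then consider "card (C - {F}) = 0" | "card (C - {F}) = 1" | "card (C - {F}) = 2" by linarith
  then show ?thesis
  proof cases
    case 1
    then have e: "C - {F} = {}" using assms(1) card_0_eq[of "C - {F}"] by blast
    show ?thesis using eq(1) unfolding e by simp
  next
    case 2
    then obtain G where G: "C - {F} = {G}" by (auto simp: card_1_singleton_iff)
    then have "F \<noteq> G" by auto
    then obtain y where "(y \<in> F) \<noteq> (y \<in> G)" by blast
    then show ?thesis using eq(1) eq(2)[of y] unfolding G by (cases "y \<in> F") auto
  next
    case 3
    then obtain G H where GH: "C - {F} = {G, H}" "G \<noteq> H" by (auto simp: card_2_iff)
    then have "F \<noteq> G" "F \<noteq> H" by auto
    then show ?thesis
      using affine_dep_three[of F G H "x F" "x G" "x H"] eq GH(2) unfolding GH(1)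
      by (simp add: add.assoc del: sum_mult_of_bool_eq sum_of_bool_mult_eq)
  qed
qed

lemma affine_dep_remove:
  assumes "finite C" "affine_dep C x" "z \<in> C" "x z = 0"
  shows "affine_dep (C - {z}) x"
  using assms(2,4) unfolding affine_dep_def sum.remove[OF assms(1,3)] by simp

lemma affine_dep_card_4:
  assumes "card C = 4" "affine_dep C x" "F \<in> C" "G \<in> C"
  shows "\<bar>x F\<bar> = \<bar>x G\<bar>"
proof (cases "F = G")
  case False
  have fin: "finite C" using assms(1) by (metis card.infinite zero_neq_numeral)
  have "card (C - {F, G}) = 2" using assms False fin by (simp add: card_Diff_subset)
  then obtain H K where HK: "C - {F, G} = {H, K}" "H \<noteq> K" by (auto simp: card_2_iff)
  have C: "C = {F, G, H, K}" using HK(1) assms(3,4) by blast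
  have ne: "F \<noteq> H" "F \<noteq> K" "G \<noteq> H" "G \<noteq> K" using HK by auto
  show ?thesis
    using assms(2) affine_dep_four[of F G H K "x F" "x G" "x H" "x K"] ne False HK(2)
    unfolding affine_dep_def C
    by (simp add: add.assoc del: sum_mult_of_bool_eq sum_of_bool_mult_eq)
qed auto

text \<open>Five vertices of a cube do not lie in a common plane, so their affine dependences form a space
  of dimension at most one, and such a dependence is determined by one suitable coefficient.\<close>
lemma affine_dep_card_5:
  assumes "card C = 5"
  shows "\<exists>z\<in>C. \<forall>x. affine_dep C x \<and> x z = 0 \<longrightarrow> (\<forall>F\<in>C. x F = 0)"
proof (rule ccontr)
  assume contra: "\<not> ?thesis"
  have fin: "finite C" using assms by (metis card.infinite zero_neq_numeral)
  from assms obtain p where p: "p \<in> C" by fastforce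
  then have "card (C - {p}) = 4" using assms fin by simp
  then obtain q where q: "q \<in> C" "q \<noteq> p" by (metis Diff_iff card.empty equals0I singletonI zero_neq_numeral)
  then have "card (C - {p} - {q}) = 3" using assms fin p by simp
  then obtain r t u where rtu: "C - {p} - {q} = {r, t, u}" "r \<noteq> t" "r \<noteq> u" "t \<noteq> u"
    by (auto simp: card_3_iff)
  then have mem: "r \<in> C" "t \<in> C" "r \<noteq> p" "r \<noteq> q" "t \<noteq> p" "t \<noteq> q" using rtu(1) by blast+
  have eqabs: "\<bar>x F\<bar> = \<bar>x G\<bar>" if "affine_dep C x" "z \<in> C" "x z = 0" "F \<in> C - {z}" "G \<in> C - {z}" for x z F G
    using affine_dep_card_4[of "C - {z}" x F G] affine_dep_remove[OF fin that(1,2,3)] that assms fin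
    by simp
  obtain X where X: "affine_dep C X" "X p = 0" "\<exists>F\<in>C. X F \<noteq> 0" using contra p by blast
  obtain Y where Y: "affine_dep C Y" "Y q = 0" "\<exists>F\<in>C. Y F \<noteq> 0" using contra q by blast
  define \<alpha> \<beta> where "\<alpha> = \<bar>X r\<bar>" and "\<beta> = \<bar>Y r\<bar>"
  have Xa: "\<bar>X F\<bar> = \<alpha>" if "F \<in> C" "F \<noteq> p" for F
    unfolding \<alpha>_def by (rule eqabs[OF X(1) p X(2)]) (use that mem in auto)
  have Yb: "\<bar>Y F\<bar> = \<beta>" if "F \<in> C" "F \<noteq> q" for F
    unfolding \<beta>_def by (rule eqabs[OF Y(1) q(1) Y(2)]) (use that mem in auto)
  have pos: "\<alpha> > 0" "\<beta> > 0"
    using X(2,3) Xa Y(2,3) Yb by (metis zero_less_abs_iff)+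
  \<comment> \<open>All nonzero coefficients of \<open>X\<close> have modulus \<open>\<alpha>\<close> and those of \<open>Y\<close> have modulus \<open>\<beta>\<close>. The
    combination \<open>Q\<close> vanishes at \<open>r\<close>, so its other coefficients have equal modulus as well; but this
    modulus is \<open>\<alpha> * \<beta>\<close> at \<open>q\<close>, and \<open>0\<close> or \<open>2 * \<alpha> * \<beta>\<close> at \<open>t\<close>.\<close>
  define Q where "Q = (\<lambda>F. Y r * X F - X r * Y F)"
  have lin: "(\<Sum>G\<in>C. f G * Q G) = Y r * (\<Sum>G\<in>C. f G * X G) - X r * (\<Sum>G\<in>C. f G * Y G)" for f
    unfolding Q_def sum_distrib_left sum_subtractf[symmetric]
    by (rule sum.cong) (auto simp: algebra_simps)
  have "affine_dep C Q"
    using X(1) Y(1) lin[of "\<lambda>_. 1"] unfolding affine_dep_def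
    by (simp add: lin del: sum_mult_of_bool_eq sum_of_bool_mult_eq)
  moreover have "Q r = 0" by (simp add: Q_def)
  ultimately have "\<bar>Q q\<bar> = \<bar>Q t\<bar>" using eqabs[of Q r q t] mem q rtu(2) by simp
  moreover have "\<bar>Q q\<bar> = \<alpha> * \<beta>" using Xa[of q] Yb[of r] mem q Y(2) by (simp add: Q_def abs_mult)
  moreover have "Q t = 0 \<or> \<bar>Q t\<bar> = 2 * (\<alpha> * \<beta>)"
  proof -
    have "X r = \<alpha> \<or> X r = - \<alpha>" "X t = \<alpha> \<or> X t = - \<alpha>" "Y r = \<beta> \<or> Y r = - \<beta>" "Y t = \<beta> \<or> Y t = - \<beta>"
      using Xa[of r] Xa[of t] Yb[of r] Yb[of t] mem by linarith+
    then show ?thesis using pos unfolding Q_def by (auto simp: abs_mult algebra_simps)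
  qed
  ultimately show False using pos by auto
qed

section \<open>Splitting a graph into parts of small degree\<close>

text \<open>Lovasz's partition of a graph of maximum degree at most \<open>k\<close> into \<open>t\<close> parts whose induced
  subgraphs have maximum degree at most \<open>d\<close>. A colouring with the fewest monochromatic edges works:
  if \<open>v\<close> had more than \<open>d\<close> neighbours of its own colour, recolouring it with a colour that occurs at
  most \<open>d\<close> times among its neighbours would remove a monochromatic edge.\<close>
lemma exists_balanced_colouring:
  fixes R :: "'a \<Rightarrow> 'a \<Rightarrow> bool"
  assumes fin: "finite V" and sym: "\<And>u v. R u v \<Longrightarrow> R v u"
    and deg: "\<And>v. v \<in> V \<Longrightarrow> card {u \<in> V - {v}. R v u} \<le> k"
    and "k < (d + 1) * t"
  shows "\<exists>c. (\<forall>v\<in>V. c v < t) \<and> (\<forall>v\<in>V. card {u \<in> V - {v}. R v u \<and> c u = c v} \<le> d)"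
proof -
  define mono where "mono c = {p \<in> V \<times> V. fst p \<noteq> snd p \<and> R (fst p) (snd p) \<and> c (fst p) = c (snd p)}" for c :: "'a \<Rightarrow> nat"
  define ok where "ok c \<longleftrightarrow> (\<forall>v\<in>V. c v < t)" for c
  have "t > 0" using assms(4) by (cases t) auto
  then have "ok (\<lambda>_. 0)" by (simp add: ok_def)
  then obtain c where c: "ok c" "\<And>c'. ok c' \<Longrightarrow> card (mono c) \<le> card (mono c')"
    using ex_has_least_nat[of ok _ "\<lambda>c. card (mono c)"] by blast
  have "card {u \<in> V - {v}. R v u \<and> c u = c v} \<le> d" if v: "v \<in> V" for v
  proof (rule ccontr)
    assume own: "\<not> ?thesis"
    define N where "N i = {u \<in> V - {v}. R v u \<and> c u = i}" for i
    have "\<exists>i<t. card (N i) \<le> d"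
    proof (rule ccontr)
      assume "\<not> ?thesis"
      then have "(\<Sum>i<t. d + 1) \<le> (\<Sum>i<t. card (N i))" by (intro sum_mono) (auto simp: not_le Suc_le_eq)
      also have "\<dots> = card (\<Union>i<t. N i)"
        by (rule card_UN_disjoint[symmetric]) (auto simp: N_def fin)
      also have "(\<Union>i<t. N i) = {u \<in> V - {v}. R v u}" using c(1) by (auto simp: N_def ok_def)
      also have "card \<dots> \<le> k" by (rule deg[OF v])
      finally show False using assms(4) by (simp add: mult.commute)
    qed
    then obtain i where i: "i < t" "card (N i) \<le> d" by blast
    define c' where "c' = c(v := i)"
    have "ok c'" using c(1) i by (simp add: c'_def ok_def)
    \<comment> \<open>\<open>Q\<close> is the set of monochromatic edges that avoid \<open>v\<close>. Edges are ordered pairs, so each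
      edge at \<open>v\<close> is counted twice.\<close>
    define Q where "Q = {p \<in> V \<times> V. fst p \<noteq> v \<and> snd p \<noteq> v \<and> fst p \<noteq> snd p \<and> R (fst p) (snd p) \<and> c (fst p) = c (snd p)}"
    have finQ: "finite Q" unfolding Q_def using fin by simp
    have finN: "finite (N j)" for j using fin by (simp add: N_def)
    have split: "mono f = Q \<union> (Pair v ` N j \<union> (\<lambda>u. (u, v)) ` N j)"
      if "f = c(v := j)" for f j
      using v sym unfolding that mono_def Q_def N_def by (auto simp: image_iff)
    have cardm: "card (mono f) = card Q + (card (N j) + card (N j))" if "f = c(v := j)" for f j
    proof -
      have "card (Pair v ` N j \<union> (\<lambda>u. (u, v)) ` N j) = card (N j) + card (N j)"
        using finN by (subst card_Un_disjoint) (auto simp: N_def card_image inj_on_def)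
      then show ?thesis unfolding split[OF that]
        using finN finQ by (subst card_Un_disjoint) (auto simp: Q_def)
    qed
    have "card (mono c') < card (mono c)"
      using cardm[of c' i] cardm[of c "c v"] i own by (simp add: c'_def N_def)
    then show False using c(2)[OF \<open>ok c'\<close>] by simp
  qed
  then show ?thesis using c(1) unfolding ok_def by blast
qed

section \<open>The graph of exceptional pairs\<close>

locale two_almost_fisher =
  fixes n l :: nat and Fam :: "nat set set"
  assumes fam: "almost_fisher n 2 l Fam"
begin

lemma finite_Fam: "finite Fam"
  using fam unfolding almost_fisher_def by (meson finite_Pow_iff finite_atLeastAtMost rev_finite_subset)

lemma member_subset: "F \<in> Fam \<Longrightarrow> F \<subseteq> {1..n}"
  using fam unfolding almost_fisher_def by auto

lemma member_finite: "F \<in> Fam \<Longrightarrow> finite F"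
  using member_subset finite_subset by blast

text \<open>Two members are adjacent if their intersection has the wrong size. In this graph every vertex
  has degree at most 2, so the connected components are paths and cycles.\<close>
definition adj :: "nat set \<Rightarrow> nat set \<Rightarrow> bool" where
  "adj F G \<longleftrightarrow> F \<in> Fam \<and> G \<in> Fam \<and> F \<noteq> G \<and> card (F \<inter> G) \<noteq> l"

lemma adj_sym: "adj F G \<Longrightarrow> adj G F"
  by (auto simp: adj_def Int_commute)

definition nbrs :: "nat set \<Rightarrow> nat set set" where
  "nbrs F = {G. adj F G}"

lemma finite_nbrs: "finite (nbrs F)"
  using finite_Fam by (rule rev_finite_subset) (auto simp: nbrs_def adj_def)

lemma card_nbrs: "card (nbrs F) \<le> 2"
proof (cases "F \<in> Fam")
  case True
  then have "nbrs F = {F' \<in> Fam - {F}. card (F \<inter> F') \<noteq> l}" by (auto simp: nbrs_def adj_def)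
  then show ?thesis using fam True by (simp add: almost_fisher_def)
next
  case False
  then have "nbrs F = {}" by (auto simp: nbrs_def adj_def)
  then show ?thesis by simp
qed

lemma nbrs_subset_pair:
  assumes "adj r p" "adj r q" "p \<noteq> q"
  shows "nbrs r = {p, q}"
proof -
  have "{p, q} \<subseteq> nbrs r" using assms by (auto simp: nbrs_def)
  then show ?thesis
    using card_seteq[OF finite_nbrs, of "{p, q}" r] card_nbrs[of r] assms(3) by simp
qed

text \<open>\<open>cls F\<close> is the connected component of \<open>F\<close>, and \<open>classes\<close> is the set of all components.\<close>
definition cls :: "nat set \<Rightarrow> nat set set" where
  "cls F = {G. adj\<^sup>*\<^sup>* F G}"

definition classes :: "nat set set set" where
  "classes = cls ` Fam"

lemma cls_self: "F \<in> cls F" by (simp add: cls_def)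

lemma reach_sym: "adj\<^sup>*\<^sup>* F G \<Longrightarrow> adj\<^sup>*\<^sup>* G F"
  by (metis adj_sym sympD sympI symp_rtranclp)

lemma cls_eq: "G \<in> cls F \<Longrightarrow> cls G = cls F"
  unfolding cls_def using reach_sym by (auto intro: rtranclp_trans)

lemma cls_subset: "F \<in> Fam \<Longrightarrow> cls F \<subseteq> Fam"
proof
  fix G assume F: "F \<in> Fam" and "G \<in> cls F"
  then have "adj\<^sup>*\<^sup>* F G" by (simp add: cls_def)
  then show "G \<in> Fam" using F by (induction rule: rtranclp_induct) (auto simp: adj_def)
qed

lemma class_subset: "C \<in> classes \<Longrightarrow> C \<subseteq> Fam"
  using cls_subset by (auto simp: classes_def)

lemma class_finite: "C \<in> classes \<Longrightarrow> finite C"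
  using class_subset finite_Fam finite_subset by blast

lemma finite_classes: "finite classes"
  by (simp add: classes_def finite_Fam)

lemma class_eq_cls: "C \<in> classes \<Longrightarrow> F \<in> C \<Longrightarrow> C = cls F"
  unfolding classes_def using cls_eq by blast

lemma class_nonempty: "C \<in> classes \<Longrightarrow> C \<noteq> {}"
  using cls_self by (auto simp: classes_def)

lemma class_closed: "C \<in> classes \<Longrightarrow> F \<in> C \<Longrightarrow> adj F G \<Longrightarrow> G \<in> C"
  using class_eq_cls[of C F] by (auto simp: cls_def)

lemma classes_disjoint: "C \<in> classes \<Longrightarrow> D \<in> classes \<Longrightarrow> C \<noteq> D \<Longrightarrow> C \<inter> D = {}"
  using class_eq_cls by blast

lemma Union_classes: "\<Union>classes = Fam"
  using class_subset cls_self by (auto simp: classes_def)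

lemma card_Fam: "card Fam = (\<Sum>C\<in>classes. card C)"
proof -
  have "card (\<Union>classes) = (\<Sum>C\<in>classes. card C)"
    by (rule card_Union_disjoint) (auto simp: pairwise_def disjnt_def classes_disjoint class_finite)
  then show ?thesis by (simp add: Union_classes)
qed

text \<open>A subset of a class that is closed under adjacency is the whole class.\<close>
lemma class_eq_closed:
  assumes "C \<in> classes" "F \<in> C" "F \<in> S" "\<And>G H. G \<in> S \<Longrightarrow> adj G H \<Longrightarrow> H \<in> S"
  shows "C \<subseteq> S"
proof
  fix G assume "G \<in> C"
  then have "adj\<^sup>*\<^sup>* F G" using class_eq_cls[OF assms(1,2)] by (simp add: cls_def)
  then show "G \<in> S" using assms(3,4) by (induction rule: rtranclp_induct) auto
qed

lemma class_nbr:
  assumes "C \<in> classes" "F \<in> C" "card C \<ge> 2"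
  obtains G where "G \<in> C" "adj F G"
proof -
  have "\<exists>G. adj F G"
  proof (rule ccontr)
    assume "\<not> ?thesis"
    then have "C \<subseteq> {F}" using class_eq_closed[OF assms(1,2), of "{F}"] by auto
    then have "card C \<le> card {F}" by (rule card_mono[rotated]) simp
    then show False using assms(3) by simp
  qed
  then show ?thesis using that class_closed[OF assms(1,2)] by blast
qed

section \<open>The reduced Gram matrix and its kernel\<close>

text \<open>The Gram matrix of the indicator vectors minus \<open>l\<close> times the all-ones matrix. Off the diagonal
  it is supported on the edges of the graph, so it is block diagonal with respect to the
  components.\<close>
definition dev :: "nat set \<Rightarrow> nat set \<Rightarrow> real" where
  "dev F G = real (card (F \<inter> G)) - real l"

lemma dev_sym: "dev F G = dev G F" by (simp add: dev_def Int_commute)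

lemma dev_adj: "adj F G \<Longrightarrow> dev F G \<noteq> 0" by (simp add: dev_def adj_def)

lemma dev_nonadj: "F \<in> Fam \<Longrightarrow> G \<in> Fam \<Longrightarrow> F \<noteq> G \<Longrightarrow> \<not> adj F G \<Longrightarrow> dev F G = 0"
  by (simp add: dev_def adj_def)

definition in_kernel :: "(nat set \<Rightarrow> real) \<Rightarrow> bool" where
  "in_kernel x \<longleftrightarrow> (\<forall>F\<in>Fam. (\<Sum>G\<in>Fam. dev F G * x G) = 0)"

lemma kernel_row:
  assumes "in_kernel x" "F \<in> Fam"
  shows "dev F F * x F + (\<Sum>G\<in>nbrs F. dev F G * x G) = 0"
proof -
  have sub: "insert F (nbrs F) \<subseteq> Fam" using assms by (auto simp: nbrs_def adj_def)
  have "(\<Sum>G\<in>Fam. dev F G * x G) = (\<Sum>G\<in>insert F (nbrs F). dev F G * x G)"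
    using assms(2) dev_nonadj
    by (intro sum.mono_neutral_right[OF finite_Fam sub]) (auto simp: nbrs_def)
  also have "\<dots> = dev F F * x F + (\<Sum>G\<in>nbrs F. dev F G * x G)"
    by (rule sum.insert[OF finite_nbrs]) (simp add: nbrs_def adj_def)
  finally show ?thesis using assms by (simp add: in_kernel_def)
qed

text \<open>If a kernel vector vanishes at a vertex and at all of its neighbours but one, then it vanishes
  at the remaining neighbour.\<close>
lemma kernel_step:
  assumes "in_kernel x" "adj r p" "x r = 0" "\<And>q. q \<in> nbrs r - {p} \<Longrightarrow> x q = 0"
  shows "x p = 0"
proof -
  have p: "p \<in> nbrs r" using assms by (simp add: nbrs_def)
  have "(\<Sum>G\<in>nbrs r. dev r G * x G) = dev r p * x p + (\<Sum>G\<in>nbrs r - {p}. dev r G * x G)"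
    by (rule sum.remove[OF finite_nbrs p])
  also have "(\<Sum>G\<in>nbrs r - {p}. dev r G * x G) = 0" using assms(4) by (simp add: sum.neutral)
  finally show ?thesis
    using kernel_row[OF assms(1), of r] assms(2,3) dev_adj[OF assms(2)] by (simp add: adj_def)
qed

text \<open>On a path or a cycle, two consecutive zeros of a kernel vector propagate to the whole
  component.\<close>
lemma kernel_zero_of_edge:
  assumes "C \<in> classes" "p \<in> C" "in_kernel x" "adj p q" "x p = 0" "x q = 0"
  shows "\<forall>F\<in>C. x F = 0"
proof -
  have step: "\<forall>H\<in>nbrs r. x H = 0" if "adj r s" "x r = 0" "x s = 0" for r s
  proof
    fix H assume H: "H \<in> nbrs r"
    show "x H = 0"
    proof (cases "H = s")
      case False
      then have "nbrs r = {H, s}" using nbrs_subset_pair H that by (simp add: nbrs_def)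
      then show ?thesis using kernel_step[OF assms(3), of r H] H that by (auto simp: nbrs_def)
    qed (use that in simp)
  qed
  have "C \<subseteq> {r. x r = 0 \<and> (\<forall>H\<in>nbrs r. x H = 0)}"
  proof (rule class_eq_closed[OF assms(1,2)])
    show "p \<in> {r. x r = 0 \<and> (\<forall>H\<in>nbrs r. x H = 0)}" using step[OF assms(4-6)] assms(5) by blast
  next
    fix G H assume GH: "G \<in> {r. x r = 0 \<and> (\<forall>H\<in>nbrs r. x H = 0)}" "adj G H"
    then have "x G = 0" "x H = 0" by (auto simp: nbrs_def)
    then show "H \<in> {r. x r = 0 \<and> (\<forall>H\<in>nbrs r. x H = 0)}" using step[of H G] GH(2) adj_sym by blast
  qed
  then show ?thesis by blast
qed

definition restrict_class :: "nat set set \<Rightarrow> (nat set \<Rightarrow> real) \<Rightarrow> nat set \<Rightarrow> real" where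
  "restrict_class C x = (\<lambda>F. if F \<in> C then x F else 0)"

lemma sum_restrict_class:
  assumes "C \<in> classes"
  shows "(\<Sum>G\<in>Fam. f G * restrict_class C x G) = (\<Sum>G\<in>C. f G * x G)"
proof -
  have "(\<Sum>G\<in>Fam. f G * restrict_class C x G) = (\<Sum>G\<in>C. f G * restrict_class C x G)"
    by (rule sum.mono_neutral_right[OF finite_Fam class_subset[OF assms]])
      (simp add: restrict_class_def)
  also have "\<dots> = (\<Sum>G\<in>C. f G * x G)" by (rule sum.cong) (auto simp: restrict_class_def)
  finally show ?thesis .
qed

lemma in_kernel_restrict_class:
  assumes "C \<in> classes" "in_kernel x"
  shows "in_kernel (restrict_class C x)"
  unfolding in_kernel_def
proof
  fix F assume F: "F \<in> Fam"
  show "(\<Sum>G\<in>Fam. dev F G * restrict_class C x G) = 0"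
  proof (cases "F \<in> C")
    case True
    have "(\<Sum>G\<in>Fam. dev F G * x G) = (\<Sum>G\<in>C. dev F G * x G)"
      using class_closed[OF assms(1) True] dev_nonadj[OF F] True
      by (intro sum.mono_neutral_right[OF finite_Fam class_subset[OF assms(1)]]) auto
    then show ?thesis using assms F by (simp add: sum_restrict_class in_kernel_def)
  next
    case False
    have "dev F G = 0" if "G \<in> C" for G
    proof -
      have "\<not> adj F G" using class_closed[OF assms(1) that] adj_sym False by blast
      then show ?thesis using dev_nonadj[OF F] class_subset[OF assms(1)] that False by blast
    qed
    then show ?thesis by (simp add: sum_restrict_class[OF assms(1)])
  qed
qed

definition total :: "(nat set \<Rightarrow> real) \<Rightarrow> real" where
  "total x = (\<Sum>G\<in>Fam. x G)"

text \<open>\<open>combo x\<close> is the linear combination, with coefficients \<open>x\<close>, of the indicator vectors of the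
  members.\<close>
definition combo :: "(nat set \<Rightarrow> real) \<Rightarrow> nat \<Rightarrow> real" where
  "combo x y = (\<Sum>G\<in>Fam. of_bool (y \<in> G) * x G)"

lemma total_restrict_class: "C \<in> classes \<Longrightarrow> total (restrict_class C x) = (\<Sum>G\<in>C. x G)"
  using sum_restrict_class[of C "\<lambda>_. 1"] by (simp add: total_def)

lemma combo_restrict_class:
  "C \<in> classes \<Longrightarrow> combo (restrict_class C x) y = (\<Sum>G\<in>C. of_bool (y \<in> G) * x G)"
  unfolding combo_def by (rule sum_restrict_class)

lemma combo_outside: "y \<notin> {1..n} \<Longrightarrow> combo x y = 0"
  unfolding combo_def by (rule sum.neutral) (use member_subset in fastforce)

lemma sum_combo_mult:
  "(\<Sum>y=1..n. combo x y * g y) = (\<Sum>G\<in>Fam. x G * (\<Sum>y\<in>G. g y))"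
proof -
  have "(\<Sum>y=1..n. combo x y * g y) = (\<Sum>y=1..n. \<Sum>G\<in>Fam. of_bool (y \<in> G) * x G * g y)"
    by (simp add: combo_def sum_distrib_right del: sum_of_bool_mult_eq)
  also have "\<dots> = (\<Sum>G\<in>Fam. \<Sum>y=1..n. of_bool (y \<in> G) * x G * g y)" by (rule sum.swap)
  also have "\<dots> = (\<Sum>G\<in>Fam. x G * (\<Sum>y\<in>G. g y))"
  proof (rule sum.cong[OF refl])
    fix G assume "G \<in> Fam"
    then have "(\<Sum>y=1..n. of_bool (y \<in> G) * x G * g y) = (\<Sum>y\<in>G. of_bool (y \<in> G) * x G * g y)"
      by (intro sum.mono_neutral_right member_subset) auto
    also have "\<dots> = (\<Sum>y\<in>G. x G * g y)" by (rule sum.cong) auto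
    finally show "(\<Sum>y=1..n. of_bool (y \<in> G) * x G * g y) = x G * (\<Sum>y\<in>G. g y)"
      by (simp add: sum_distrib_left)
  qed
  finally show ?thesis .
qed

lemma sum_combo_over_member:
  assumes "F \<in> Fam"
  shows "(\<Sum>y\<in>F. combo x y) = (\<Sum>G\<in>Fam. real (card (F \<inter> G)) * x G)"
proof -
  have "(\<Sum>y\<in>F. combo x y) = (\<Sum>G\<in>Fam. \<Sum>y\<in>F. of_bool (y \<in> G) * x G)"
    unfolding combo_def by (rule sum.swap)
  also have "\<dots> = (\<Sum>G\<in>Fam. real (card (F \<inter> G)) * x G)"
  proof (rule sum.cong[OF refl])
    fix G
    have "(\<Sum>y\<in>F. of_bool (y \<in> G) * x G) = (\<Sum>y\<in>F \<inter> {y. y \<in> G}. x G)"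
      by (rule sum_of_bool_mult_eq) (rule member_finite[OF assms])
    then show "(\<Sum>y\<in>F. of_bool (y \<in> G) * x G) = real (card (F \<inter> G)) * x G" by simp
  qed
  finally show ?thesis .
qed

lemma row_eq:
  assumes "F \<in> Fam"
  shows "(\<Sum>G\<in>Fam. dev F G * x G) = (\<Sum>y\<in>F. combo x y) - real l * total x"
  by (simp add: sum_combo_over_member[OF assms] dev_def total_def algebra_simps
      sum_subtractf sum_distrib_left)

lemma in_kernelD: "in_kernel x \<Longrightarrow> F \<in> Fam \<Longrightarrow> (\<Sum>y\<in>F. combo x y) = real l * total x"
  using row_eq[of F x] by (simp add: in_kernel_def)

lemma in_kernelI:
  assumes "\<And>y. y \<in> {1..n} \<Longrightarrow> combo x y = 0" "total x = 0"
  shows "in_kernel x"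
proof -
  have "combo x y = 0" for y using assms(1) combo_outside by blast
  then show ?thesis by (simp add: in_kernel_def row_eq assms(2))
qed

lemma sum_combo_sq:
  assumes "in_kernel x"
  shows "(\<Sum>y=1..n. combo x y * combo z y) = real l * total x * total z"
proof -
  have "(\<Sum>y=1..n. combo z y * combo x y) = (\<Sum>G\<in>Fam. z G * (real l * total x))"
    unfolding sum_combo_mult using in_kernelD[OF assms] by simp
  also have "\<dots> = total z * (real l * total x)" by (simp add: total_def sum_distrib_right)
  finally show ?thesis by (simp add: mult_ac)
qed

text \<open>A kernel vector \<open>x\<close> satisfies \<open>\<parallel>combo x\<parallel>\<^sup>2 = l * (total x)\<^sup>2\<close>. Hence kernel vectors with
  coefficient sum zero are affine dependences among the members.\<close>
lemma combo_zero:
  assumes "in_kernel x" "total x = 0"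
  shows "combo x y = 0"
proof (cases "y \<in> {1..n}")
  case True
  have "(\<Sum>y=1..n. combo x y * combo x y) = 0" using sum_combo_sq[OF assms(1)] assms(2) by simp
  then have "\<forall>y\<in>{1..n}. combo x y * combo x y = 0" by (subst (asm) sum_nonneg_eq_0_iff) auto
  then show ?thesis using True by simp
qed (rule combo_outside)

lemma kernel_affine_dep:
  assumes "C \<in> classes" "in_kernel x" "(\<Sum>G\<in>C. x G) = 0"
  shows "affine_dep C x"
  unfolding affine_dep_def
  using combo_zero[OF in_kernel_restrict_class[OF assms(1,2)]] assms
  by (simp add: total_restrict_class combo_restrict_class del: sum_of_bool_mult_eq)

lemma total_lincomb: "total (\<lambda>F. a * x F + b * y F) = a * total x + b * total y"
  by (simp add: total_def sum.distrib sum_distrib_left)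

lemma combo_lincomb: "combo (\<lambda>F. a * x F + b * y F) v = a * combo x v + b * combo y v"
  unfolding combo_def sum_distrib_left sum.distrib[symmetric]
  by (rule sum.cong) (auto simp: algebra_simps)

lemma in_kernel_lincomb:
  assumes "in_kernel x" "in_kernel y"
  shows "in_kernel (\<lambda>F. a * x F + b * y F)"
  unfolding in_kernel_def
proof
  fix F assume F: "F \<in> Fam"
  have "(\<Sum>G\<in>Fam. dev F G * (a * x G + b * y G))
      = a * (\<Sum>G\<in>Fam. dev F G * x G) + b * (\<Sum>G\<in>Fam. dev F G * y G)"
    unfolding sum_distrib_left sum.distrib[symmetric]
    by (rule sum.cong) (auto simp: algebra_simps)
  then show "(\<Sum>G\<in>Fam. dev F G * (a * x G + b * y G)) = 0"
    using assms F by (simp add: in_kernel_def)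
qed

text \<open>All kernel vectors with the same coefficient sum represent the same point.\<close>
lemma combo_unique:
  assumes "in_kernel x" "in_kernel z" "total x = total z"
  shows "combo x y = combo z y"
  using combo_zero[OF in_kernel_lincomb[OF assms(1,2), of 1 "- 1"], of y] assms(3)
    total_lincomb[of 1 x "- 1" z] combo_lincomb[of 1 x "- 1" z y] by simp

section \<open>A bound in terms of special components\<close>

text \<open>In a component \<open>C\<close>, the values on a small set \<open>Z\<close> determine a kernel vector, where for
  \<open>card C \<le> 5\<close> the kernel vector is also required to have sum zero on \<open>C\<close>. The set \<open>Z\<close> has 0, 1 or 2
  elements according to whether \<open>card C\<close> is at most 3, is 4 or 5, or is at least 6; the summand
  \<open>card Z mod 2\<close> records that a single element is only needed for \<open>card C \<ge> 4\<close>.\<close>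
lemma class_affine_forcing:
  assumes C: "C \<in> classes"
  shows "\<exists>Z\<subseteq>C. 3 * card Z + card Z mod 2 \<le> card C \<and>
    (\<forall>x. in_kernel x \<and> (card C \<le> 5 \<longrightarrow> (\<Sum>G\<in>C. x G) = 0) \<and> (\<forall>F\<in>Z. x F = 0) \<longrightarrow> (\<forall>F\<in>C. x F = 0))"
proof -
  have fin: "finite C" by (rule class_finite[OF C])
  consider "card C \<le> 3" | "card C = 4" | "card C = 5" | "card C \<ge> 6" by linarith
  then show ?thesis
  proof cases
    case 1
    then show ?thesis
      using affine_dep_card_le_3[OF fin 1] kernel_affine_dep[OF C] by (intro exI[of _ "{}"]) auto
  next
    case 2
    then obtain z where z: "z \<in> C" using class_nonempty[OF C] by blast
    have "\<forall>F\<in>C. x F = 0" if "in_kernel x" "(\<Sum>G\<in>C. x G) = 0" "x z = 0" for x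
      using affine_dep_card_4[OF 2 kernel_affine_dep[OF C that(1,2)] _ z] that(3) by simp
    then show ?thesis using z 2 by (intro exI[of _ "{z}"]) auto
  next
    case 3
    then obtain z where z: "z \<in> C" "\<And>x. affine_dep C x \<Longrightarrow> x z = 0 \<Longrightarrow> \<forall>F\<in>C. x F = 0"
      using affine_dep_card_5 by blast
    then show ?thesis using kernel_affine_dep[OF C] 3 by (intro exI[of _ "{z}"]) auto
  next
    case 4
    obtain p where p: "p \<in> C" using class_nonempty[OF C] by blast
    obtain q where q: "q \<in> C" "adj p q" using class_nbr[OF C p] 4 by auto
    then have "p \<noteq> q" by (auto simp: adj_def)
    then show ?thesis
      using kernel_zero_of_edge[OF C p _ q(2)] p q(1) 4 by (intro exI[of _ "{p, q}"]) auto
  qed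
qed

text \<open>A component with at most five members is special if some kernel vector has nonzero sum on it.\<close>
definition special :: "nat set set set" where
  "special = {C \<in> classes. card C \<le> 5 \<and> (\<exists>x. in_kernel x \<and> (\<Sum>G\<in>C. x G) \<noteq> 0)}"

lemma finite_special: "finite special" by (simp add: special_def finite_classes)

lemma sum_mod_2_le: "finite I \<Longrightarrow> (\<Sum>i\<in>I. f i) mod 2 \<le> (\<Sum>i\<in>I. f i mod (2::nat))"
  by (induction I rule: finite_induct) (auto, presburger)

text \<open>A choice of one subset in each component, together with the union of the chosen subsets.\<close>
lemma classes_choose:
  assumes "\<And>C. C \<in> classes \<Longrightarrow> \<exists>Z\<subseteq>C. P C Z"
  obtains Zf where "\<And>C. C \<in> classes \<Longrightarrow> Zf C \<subseteq> C \<and> P C (Zf C)"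
    and "(\<Union>C\<in>classes. Zf C) \<subseteq> Fam"
    and "card (\<Union>C\<in>classes. Zf C) = (\<Sum>C\<in>classes. card (Zf C))"
proof -
  from assms obtain Zf where Zf: "\<And>C. C \<in> classes \<Longrightarrow> Zf C \<subseteq> C \<and> P C (Zf C)" by metis
  have "card (\<Union>C\<in>classes. Zf C) = (\<Sum>C\<in>classes. card (Zf C))"
  proof (rule card_UN_disjoint[OF finite_classes])
    show "\<forall>C\<in>classes. finite (Zf C)" using Zf class_finite finite_subset by blast
    show "\<forall>C\<in>classes. \<forall>D\<in>classes. C \<noteq> D \<longrightarrow> Zf C \<inter> Zf D = {}"
      using Zf classes_disjoint by blast
  qed
  moreover have "(\<Union>C\<in>classes. Zf C) \<subseteq> Fam" using Zf class_subset by blast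
  ultimately show ?thesis using that Zf by blast
qed

lemma sum_delta_Fam:
  "z \<in> Fam \<Longrightarrow> (\<Sum>G\<in>Fam. of_bool (G = z) * x G) = (x z :: real)"
proof -
  assume z: "z \<in> Fam"
  have "(\<Sum>G\<in>Fam. of_bool (G = z) * x G) = (\<Sum>G\<in>{z}. of_bool (G = z) * x G)"
    by (rule sum.mono_neutral_right[OF finite_Fam]) (use z in auto)
  then show ?thesis by simp
qed

text \<open>Consider the coefficient vectors \<open>x\<close> with \<open>combo x = 0\<close> and \<open>total x = 0\<close> that vanish on the
  determining sets of all components and have sum zero on each special component. Such a vector lies
  in the kernel, so it is zero; the number of these equations therefore bounds the number of
  members.\<close>
lemma card_Fam_le_special:
  "\<exists>z. 3 * z + z mod 2 \<le> card Fam \<and> card Fam \<le> n + 1 + z + card special"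
proof -
  obtain Zf where Zf: "\<And>C. C \<in> classes \<Longrightarrow> Zf C \<subseteq> C \<and>
      (3 * card (Zf C) + card (Zf C) mod 2 \<le> card C \<and>
      (\<forall>x. in_kernel x \<and> (card C \<le> 5 \<longrightarrow> (\<Sum>G\<in>C. x G) = 0) \<and> (\<forall>F\<in>Zf C. x F = 0) \<longrightarrow> (\<forall>F\<in>C. x F = 0)))"
    and sub: "(\<Union>C\<in>classes. Zf C) \<subseteq> Fam"
    and card: "card (\<Union>C\<in>classes. Zf C) = (\<Sum>C\<in>classes. card (Zf C))"
    using classes_choose[OF class_affine_forcing] by blast
  define Z where "Z = (\<Union>C\<in>classes. Zf C)"
  have finZ: "finite Z" using sub finite_Fam finite_subset unfolding Z_def by blast
  have "card Z mod 2 \<le> (\<Sum>C\<in>classes. card (Zf C) mod 2)"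
    unfolding Z_def card by (rule sum_mod_2_le[OF finite_classes])
  then have "3 * card Z + card Z mod 2 \<le> (\<Sum>C\<in>classes. 3 * card (Zf C) + card (Zf C) mod 2)"
    unfolding Z_def card sum.distrib sum_distrib_left by linarith
  also have "\<dots> \<le> card Fam" unfolding card_Fam by (rule sum_mono) (use Zf in blast)
  finally have Z: "3 * card Z + card Z mod 2 \<le> card Fam" .
  define E :: "(nat set \<Rightarrow> real) set" where
    "E = (\<lambda>y G. of_bool (y \<in> G)) ` {1..n} \<union> {\<lambda>_. 1} \<union> (\<lambda>z G. of_bool (G = z)) ` Z
         \<union> (\<lambda>C G. of_bool (G \<in> C)) ` special"
  have finE: "finite E" unfolding E_def using finZ finite_special by simp
  have "card E \<le> n + 1 + card Z + card special"
    unfolding E_def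
    by (intro order.trans[OF card_Un_le] add_mono card_image_le finZ finite_special)
      (use card_image_le[of "{1..n}"] in auto)
  moreover have "card Fam \<le> card E"
  proof (rule card_le_card_functionals[OF finE finite_Fam])
    fix x assume x: "\<And>e. e \<in> E \<Longrightarrow> (\<Sum>G\<in>Fam. e G * x G) = 0"
    have "combo x y = 0" if "y \<in> {1..n}" for y
      unfolding combo_def by (rule x) (use that in \<open>auto simp: E_def\<close>)
    moreover have "total x = 0" using x[of "\<lambda>_. 1"] by (simp add: total_def E_def)
    ultimately have ker: "in_kernel x" by (rule in_kernelI)
    have z: "x z = 0" if "z \<in> Z" for z
      using x[of "\<lambda>G. of_bool (G = z)"] that sub sum_delta_Fam[of z x]
      by (auto simp: E_def Z_def simp del: sum_of_bool_mult_eq)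
    show "\<forall>F\<in>Fam. x F = 0"
    proof
      fix F assume "F \<in> Fam"
      then obtain C where C: "C \<in> classes" "F \<in> C" using Union_classes by blast
      have "(\<Sum>G\<in>C. x G) = 0" if "card C \<le> 5"
      proof (cases "C \<in> special")
        case True
        have "(\<Sum>G\<in>Fam. of_bool (G \<in> C) * x G) = 0" by (rule x) (use True in \<open>auto simp: E_def\<close>)
        moreover have "(\<Sum>G\<in>Fam. of_bool (G \<in> C) * x G) = (\<Sum>G\<in>C. x G)"
          using class_subset[OF C(1)] finite_Fam by (simp add: Int_absorb1)
        ultimately show ?thesis by simp
      next
        case False
        then show ?thesis using C ker that by (auto simp: special_def)
      qed
      then show "x F = 0" using Zf[OF C(1)] ker z C unfolding Z_def by blast
    qed
  qed
  ultimately have "card Fam \<le> n + 1 + card Z + card special" by linarith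
  with Z show ?thesis by blast
qed

section \<open>Kernel vectors with nonzero coefficient sum\<close>

text \<open>If no member is too small and no isolated member has exactly \<open>l\<close> elements, then every kernel
  vector is determined by its values on half of the members.\<close>
lemma class_kernel_forcing:
  assumes C: "C \<in> classes"
    and ge: "\<And>F. F \<in> Fam \<Longrightarrow> l \<le> card F"
    and iso: "\<And>F. F \<in> Fam \<Longrightarrow> card F = l \<Longrightarrow> \<exists>G. adj F G"
  shows "\<exists>Z\<subseteq>C. 2 * card Z \<le> card C \<and>
    (\<forall>x. in_kernel x \<and> (\<forall>F\<in>Z. x F = 0) \<longrightarrow> (\<forall>F\<in>C. x F = 0))"
proof -
  have fin: "finite C" by (rule class_finite[OF C])
  have card0: "card C \<noteq> 0" using fin class_nonempty[OF C] by simp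
  have inFam: "F \<in> C \<Longrightarrow> F \<in> Fam" for F using class_subset[OF C] by blast
  consider "card C = 1" | "card C = 2" | "card C = 3" | "card C \<ge> 4" using card0 by linarith
  then show ?thesis
  proof cases
    case 1
    then obtain F where F: "C = {F}" by (auto simp: card_1_singleton_iff)
    then have "nbrs F = {}" using class_closed[OF C, of F] by (auto simp: nbrs_def adj_def)
    moreover have "dev F F \<noteq> 0"
      using iso[of F] inFam[of F] \<open>nbrs F = {}\<close> F by (auto simp: dev_def nbrs_def)
    ultimately have "x F = 0" if "in_kernel x" for x using kernel_row[OF that, of F] inFam[of F] F by simp
    then show ?thesis using F by (intro exI[of _ "{}"]) auto
  next
    case 2
    then obtain p q where pq: "C = {p, q}" "p \<noteq> q" by (auto simp: card_2_iff)
    have "adj p q" using class_nbr[OF C, of p] pq 2 by (auto simp: adj_def)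
    then have nb: "nbrs p = {q}" using class_closed[OF C, of p] pq by (auto simp: nbrs_def adj_def)
    have "x q = 0" if "in_kernel x" "x p = 0" for x
      by (rule kernel_step[OF that(1) \<open>adj p q\<close> that(2)]) (simp add: nb)
    then show ?thesis using pq 2 by (intro exI[of _ "{p}"]) auto
  next
    case 3
    have Z1: ?thesis if "z \<in> C" "\<And>x. in_kernel x \<Longrightarrow> x z = 0 \<Longrightarrow> \<forall>F\<in>C. x F = 0" for z
      using that 3 by (intro exI[of _ "{z}"]) auto
    obtain p q r where pqr: "C = {p, q, r}" "p \<noteq> q" "p \<noteq> r" "q \<noteq> r"
      using 3 by (auto simp: card_3_iff)
    \<comment> \<open>On a path with three vertices a kernel vector is determined by its value at an end vertex.\<close>
    have path: ?thesis if C': "C = {u, v, w}" "u \<noteq> v" "u \<noteq> w" "v \<noteq> w" and "\<not> adj u w" for u v w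
    proof (rule Z1[of u])
      show "u \<in> C" using C' by simp
      fix x assume x: "in_kernel x" "x u = 0"
      have uv: "adj u v" using class_nbr[OF C \<open>u \<in> C\<close>] C' that(5) 3 by (auto simp: adj_def)
      then have "nbrs u \<subseteq> {v}"
        using class_closed[OF C \<open>u \<in> C\<close>] C' that(5) by (auto simp: nbrs_def adj_def)
      then have "x v = 0" by (intro kernel_step[OF x(1) uv x(2)]) auto
      then show "\<forall>F\<in>C. x F = 0" using kernel_zero_of_edge[OF C \<open>u \<in> C\<close> x(1) uv x(2)] by simp
    qed
    \<comment> \<open>In a triangle two edges have entries of the same sign; their common vertex \<open>u\<close> determines a
      kernel vector: if \<open>x u = 0\<close> but \<open>x v \<noteq> 0\<close>, then \<open>x v\<close> and \<open>x w\<close> have opposite signs and the block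
      of \<open>v\<close> and \<open>w\<close> is singular with a positive entry off the diagonal, which forces \<open>v = w\<close>.\<close>
    have triangle: ?thesis
      if C': "C = {u, v, w}" and ad: "adj u v" "adj u w" "adj v w"
        and same: "dev u v * dev u w > 0" for u v w
    proof (rule Z1[of u])
      show uC: "u \<in> C" using C' by simp
      have ne: "u \<noteq> v" "u \<noteq> w" "v \<noteq> w" using ad by (auto simp: adj_def)
      fix x assume x: "in_kernel x" "x u = 0"
      have nb: "nbrs u = {v, w}" "nbrs v = {u, w}" "nbrs w = {u, v}"
        using nbrs_subset_pair ad adj_sym ne by metis+
      have fam3: "u \<in> Fam" "v \<in> Fam" "w \<in> Fam" using ad by (auto simp: adj_def)
      have row_u: "dev u v * x v + dev u w * x w = 0"
        using kernel_row[OF x(1) fam3(1)] nb ne x(2) by simp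
      have row_v: "dev v v * x v + dev v w * x w = 0"
        using kernel_row[OF x(1) fam3(2)] nb ne x(2) by simp
      have row_w: "dev w w * x w + dev v w * x v = 0"
        using kernel_row[OF x(1) fam3(3)] nb ne x(2) by (simp add: dev_sym[of w v])
      have "x v = 0"
      proof (rule ccontr)
        assume v0: "x v \<noteq> 0"
        have "dev u v * dev u w * (x v * x w) = - ((dev u v * x v)\<^sup>2)"
        proof -
          have "dev u w * x w = - (dev u v * x v)" using row_u by linarith
          then have "(dev u v * x v) * (dev u w * x w) = - ((dev u v * x v)\<^sup>2)"
            by (simp add: power2_eq_square)
          then show ?thesis by (simp add: mult_ac)
        qed
        moreover have "(dev u v * x v)\<^sup>2 > 0" using v0 dev_adj[OF ad(1)] by simp
        ultimately have neg: "x v * x w < 0" using same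
          by (metis neg_less_0_iff_less zero_less_mult_pos linorder_neqE_linordered_idom mult_zero_right less_irrefl mult_pos_pos not_less_iff_gr_or_eq)
        have size: "dev v v \<ge> 0" "dev w w \<ge> 0" using ge fam3 by (simp_all add: dev_def)
        have le: "dev v w \<le> dev v v" "dev v w \<le> dev w w"
          using fam3 member_finite by (simp_all add: dev_def card_mono)
        have "dev v w * (x v * x w) = - (dev v v * (x v)\<^sup>2)"
          using arg_cong[OF row_v, of "\<lambda>t. t * x v"] by (simp add: power2_eq_square algebra_simps)
        then have "dev v w * (x v * x w) \<le> 0" using size by simp
        then have "dev v w > 0" using neg dev_adj[OF ad(3)] by (simp add: mult_le_0_iff)
        have "dev v v * dev w w * x v = dev v w * dev v w * x v"
        proof -
          have "dev v v * dev w w * x v = - (dev v w * (dev w w * x w))"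
            using arg_cong[OF row_v, of "\<lambda>t. t * dev w w"] by (simp add: algebra_simps)
          also have "dev w w * x w = - (dev v w * x v)" using row_w by simp
          finally show ?thesis by simp
        qed
        then have prod: "dev v v * dev w w = dev v w * dev v w" using v0 by simp
        have "dev v v = dev v w \<and> dev w w = dev v w"
        proof (rule ccontr)
          assume "\<not> ?thesis"
          then have "dev v v > dev v w \<or> dev w w > dev v w" using le by auto
          then have "dev v w * dev v w < dev v v * dev w w"
            using le \<open>dev v w > 0\<close> by (metis mult_le_less_imp_less mult_less_le_imp_less less_eq_real_def)
          then show False using prod by simp
        qed
        then have "card (v \<inter> w) = card v" "card (v \<inter> w) = card w" by (simp_all add: dev_def)
        then have "v \<inter> w = v" "v \<inter> w = w"
          using card_subset_eq[of v "v \<inter> w"] card_subset_eq[of w "v \<inter> w"] member_finite fam3 by auto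
        then show False using ne by simp
      qed
      then show "\<forall>F\<in>C. x F = 0" using kernel_zero_of_edge[OF C uC x(1) ad(1) x(2)] by simp
    qed
    show ?thesis
    proof (cases "adj p q \<and> adj p r \<and> adj q r")
      case True
      then have ad: "adj p q" "adj p r" "adj q r" "adj q p" "adj r p" "adj r q" using adj_sym by auto
      have nz: "dev p q \<noteq> 0" "dev p r \<noteq> 0" "dev q r \<noteq> 0" using ad dev_adj by auto
      then consider "dev p q * dev p r > 0" | "dev q p * dev q r > 0" | "dev r p * dev r q > 0"
        unfolding dev_sym[of q p] dev_sym[of r p] dev_sym[of r q] zero_less_mult_iff by linarith
      then show ?thesis
      proof cases
        case 1 then show ?thesis using triangle[of p q r] pqr ad by blast
      next
        case 2
        have "C = {q, p, r}" using pqr by auto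
        then show ?thesis using triangle[of q p r] 2 ad by blast
      next
        case 3
        have "C = {r, p, q}" using pqr by auto
        then show ?thesis using triangle[of r p q] 3 ad by blast
      qed
    next
      case False
      then consider "\<not> adj p q" | "\<not> adj p r" | "\<not> adj q r" by blast
      then show ?thesis
      proof cases
        case 1
        have "C = {p, r, q}" using pqr by auto
        then show ?thesis using path[of p r q] 1 pqr by blast
      next
        case 2 then show ?thesis using path[of p q r] pqr by blast
      next
        case 3
        have "C = {q, p, r}" using pqr by auto
        then show ?thesis using path[of q p r] 3 pqr by blast
      qed
    qed
  next
    case 4
    obtain p where p: "p \<in> C" using class_nonempty[OF C] by blast
    obtain q where q: "q \<in> C" "adj p q" using class_nbr[OF C p] 4 by auto
    then have "p \<noteq> q" by (auto simp: adj_def)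
    then show ?thesis
      using kernel_zero_of_edge[OF C p _ q(2)] p q(1) 4 by (intro exI[of _ "{p, q}"]) auto
  qed
qed

text \<open>The vector \<open>w = combo c\<close> is nonzero and has inner product \<open>l\<close> with every member. Hence it
  suffices to test \<open>combo x = 0\<close> outside one coordinate \<open>y0\<close> with \<open>w y0 \<noteq> 0\<close>. Since \<open>c\<close> itself is
  excluded by \<open>total x = 0\<close>, one of the determining coordinates \<open>z0\<close> can be saved as well.\<close>
lemma card_Fam_le_of_unit_kernel:
  assumes c: "in_kernel c" "total c = 1" and "l > 0"
    and ge: "\<And>F. F \<in> Fam \<Longrightarrow> l \<le> card F"
    and iso: "\<And>F. F \<in> Fam \<Longrightarrow> card F = l \<Longrightarrow> \<exists>G. adj F G"
  shows "card Fam + 2 \<le> 2 * n"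
proof -
  obtain Zf where Zf: "\<And>C. C \<in> classes \<Longrightarrow> Zf C \<subseteq> C \<and>
      (2 * card (Zf C) \<le> card C \<and>
      (\<forall>x. in_kernel x \<and> (\<forall>F\<in>Zf C. x F = 0) \<longrightarrow> (\<forall>F\<in>C. x F = 0)))"
    and sub: "(\<Union>C\<in>classes. Zf C) \<subseteq> Fam"
    and card: "card (\<Union>C\<in>classes. Zf C) = (\<Sum>C\<in>classes. card (Zf C))"
    using classes_choose[OF class_kernel_forcing[OF _ ge iso]] by blast
  define Z where "Z = (\<Union>C\<in>classes. Zf C)"
  have finZ: "finite Z" using sub finite_Fam finite_subset unfolding Z_def by blast
  have force: "\<forall>F\<in>Fam. x F = 0" if "in_kernel x" "\<forall>F\<in>Z. x F = 0" for x
  proof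
    fix F assume "F \<in> Fam"
    then obtain C where "C \<in> classes" "F \<in> C" using Union_classes by blast
    then show "x F = 0" using Zf[of C] that unfolding Z_def by blast
  qed
  have "2 * card Z \<le> card Fam"
    unfolding Z_def card card_Fam sum_distrib_left by (rule sum_mono) (use Zf in blast)
  have "\<not> (\<forall>F\<in>Fam. c F = 0)" using c(2) unfolding total_def by (metis sum.neutral zero_neq_one)
  then obtain z0 where z0: "z0 \<in> Z" "c z0 \<noteq> 0" using force[OF c(1)] by blast
  have "(\<Sum>y=1..n. combo c y * combo c y) \<noteq> 0" using sum_combo_sq[OF c(1)] c(2) \<open>l > 0\<close> by simp
  then obtain y0 where y0: "y0 \<in> {1..n}" "combo c y0 \<noteq> 0"
    by (metis (no_types, lifting) mult_zero_left sum.neutral)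
  define E :: "(nat set \<Rightarrow> real) set" where
    "E = (\<lambda>y G. of_bool (y \<in> G)) ` ({1..n} - {y0}) \<union> {\<lambda>_. 1}
         \<union> (\<lambda>z G. of_bool (G = z) - c z / c z0 * of_bool (G = z0)) ` (Z - {z0})"
  have finE: "finite E" unfolding E_def using finZ by simp
  have "card E \<le> (n - 1) + 1 + (card Z - 1)"
  proof -
    have "card ((\<lambda>y G. of_bool (y \<in> G)) ` ({1..n} - {y0}) :: (nat set \<Rightarrow> real) set) \<le> n - 1"
      using card_image_le[of "{1..n} - {y0}" "\<lambda>y (G :: nat set). of_bool (y \<in> G) :: real"] y0 by simp
    moreover have "card ((\<lambda>z G. of_bool (G = z) - c z / c z0 * of_bool (G = z0)) ` (Z - {z0})) \<le> card Z - 1"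
      using card_image_le[of "Z - {z0}" "\<lambda>z G. of_bool (G = z) - c z / c z0 * of_bool (G = z0)"] z0 finZ by simp
    ultimately show ?thesis unfolding E_def
      by (intro order.trans[OF card_Un_le] add_mono) auto
  qed
  moreover have "card Fam \<le> card E"
  proof (rule card_le_card_functionals[OF finE finite_Fam])
    fix x assume x: "\<And>e. e \<in> E \<Longrightarrow> (\<Sum>G\<in>Fam. e G * x G) = 0"
    have y: "combo x y = 0" if "y \<in> {1..n} - {y0}" for y
      unfolding combo_def by (rule x) (use that in \<open>auto simp: E_def\<close>)
    have tot: "total x = 0" using x[of "\<lambda>_. 1"] by (simp add: total_def E_def)
    have "(\<Sum>y=1..n. combo c y * combo x y) = 0" using sum_combo_sq[OF c(1), of x] tot by simp
    moreover have "(\<Sum>y=1..n. combo c y * combo x y) = combo c y0 * combo x y0"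
      using y0(1) y by (subst sum.remove[of _ y0]) (auto intro!: sum.neutral)
    ultimately have "combo x y0 = 0" using y0(2) by simp
    then have ker: "in_kernel x" using y tot by (intro in_kernelI) auto
    define \<tau> where "\<tau> = x z0 / c z0"
    define d where "d = (\<lambda>F. 1 * x F + (- \<tau>) * c F)"
    have "in_kernel d" unfolding d_def by (rule in_kernel_lincomb[OF ker c(1)])
    moreover have "\<forall>z\<in>Z. d z = 0"
    proof
      fix z assume z: "z \<in> Z"
      show "d z = 0"
      proof (cases "z = z0")
        case False
        have "0 = (\<Sum>G\<in>Fam. (of_bool (G = z) - c z / c z0 * of_bool (G = z0)) * x G)"
          by (rule x[symmetric]) (use z False in \<open>auto simp: E_def\<close>)
        also have "\<dots> = (\<Sum>G\<in>Fam. of_bool (G = z) * x G) - c z / c z0 * (\<Sum>G\<in>Fam. of_bool (G = z0) * x G)"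
          unfolding sum_distrib_left sum_subtractf[symmetric]
          by (rule sum.cong) (auto simp: algebra_simps)
        also have "\<dots> = x z - c z / c z0 * x z0"
          using sum_delta_Fam z z0 sub unfolding Z_def by (metis (no_types, lifting) subsetD)
        finally show ?thesis by (simp add: d_def \<tau>_def)
      qed (use z0 in \<open>simp add: d_def \<tau>_def\<close>)
    qed
    ultimately have d0: "\<forall>F\<in>Fam. d F = 0" by (rule force)
    then have "total d = 0" by (simp add: total_def)
    then have "\<tau> = 0" unfolding d_def total_lincomb using tot c(2) by simp
    then show "\<forall>F\<in>Fam. x F = 0" using d0 by (simp add: d_def)
  qed
  moreover have "card Z \<ge> 1" using z0 finZ by (metis One_nat_def Suc_leI card_gt_0_iff empty_iff)
  moreover have "n \<ge> 1" using y0 by simp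
  ultimately show ?thesis using \<open>2 * card Z \<le> card Fam\<close> by linarith
qed

section \<open>Families whose members share a set of l elements\<close>

text \<open>If all members contain a set \<open>W\<close> with \<open>l\<close> elements, then after removal of \<open>W\<close> two members are
  adjacent if and only if they intersect. In a component with at least four members, every point
  then lies in at most two of them, and at most half of the members are singletons; double counting
  bounds the number of members.\<close>
lemma class_core_bound:
  assumes W: "\<And>F. F \<in> Fam \<Longrightarrow> W \<subseteq> F" "finite W" "card W = l"
    and C: "C \<in> classes" "W \<notin> C"
  shows "2 * card C \<le> 3 * card (\<Union>F\<in>C. F - W)"
proof -
  define U where "U = (\<Union>F\<in>C. F - W)"
  have inFam: "F \<in> C \<Longrightarrow> F \<in> Fam" for F using class_subset[OF C(1)] by blast
  have finC: "finite C" by (rule class_finite[OF C(1)])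
  have finF: "F \<in> C \<Longrightarrow> finite (F - W)" for F using inFam member_finite by blast
  have finU: "finite U" unfolding U_def using finC finF by blast
  have ne: "F - W \<noteq> {}" if "F \<in> C" for F using W(1)[OF inFam[OF that]] C(2) that by auto
  have inj: "F = G" if "F \<in> C" "G \<in> C" "F - W = G - W" for F G
    using that W(1)[OF inFam[OF that(1)]] W(1)[OF inFam[OF that(2)]] by blast
  have adj_iff: "adj F G \<longleftrightarrow> F \<noteq> G \<and> (F - W) \<inter> (G - W) \<noteq> {}" if "F \<in> Fam" "G \<in> Fam" for F G
  proof -
    have sub: "W \<subseteq> F \<inter> G" using W(1)[OF that(1)] W(1)[OF that(2)] by blast
    have "finite (F \<inter> G)" using member_finite[OF that(1)] by blast
    then have "card (F \<inter> G) = l \<longleftrightarrow> F \<inter> G = W"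
      using card_subset_eq[OF _ sub] W(3) by metis
    moreover have "F \<inter> G = W \<longleftrightarrow> (F - W) \<inter> (G - W) = {}" using sub by blast
    ultimately show ?thesis using that unfolding adj_def by blast
  qed
  have "2 * card C \<le> 3 * card U"
  proof (cases "card C \<le> 3")
    case True
    have U1: "card U \<ge> 1" using ne class_nonempty[OF C(1)] finU unfolding U_def
      by (metis One_nat_def SUP_bot_conv(1) Suc_leI card_gt_0_iff ex_in_conv)
    show ?thesis
    proof (cases "card U = 1")
      case True
      then obtain y where y: "U = {y}" by (auto simp: card_1_singleton_iff)
      have "F - W = {y}" if "F \<in> C" for F
      proof -
        have "F - W \<subseteq> {y}" using that unfolding y[symmetric] U_def by blast
        then show ?thesis using ne[OF that] by blast
      qed
      then have "F = G" if "F \<in> C" "G \<in> C" for F G using inj that by metis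
      then have "card C \<le> 1" using card_le_Suc0_iff_eq[OF finC] by simp
      then show ?thesis using True by simp
    qed (use True U1 in linarith)
  next
    case False
    have closed: "card C \<le> 3" if "F \<in> T" "F \<in> C" "card T \<le> 3" "finite T"
      "\<And>G H. G \<in> T \<Longrightarrow> adj G H \<Longrightarrow> H \<in> T" for T F
      using class_eq_closed[OF C(1) that(2,1,5)] card_mono[OF that(4)] that(3) by (meson le_trans)
    \<comment> \<open>Three members through a common point would form a complete component.\<close>
    have deg: "card {F \<in> C. y \<in> F} \<le> 2" if "y \<notin> W" for y
    proof (rule ccontr)
      define T where "T = {F \<in> C. y \<in> F}"
      assume "\<not> ?thesis"
      then have T3: "card T \<ge> 3" by (simp add: T_def)
      have finT: "finite T" using finC by (simp add: T_def)
      have nb: "nbrs F = T - {F} \<and> card T = 3" if F: "F \<in> T" for F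
      proof -
        have "T - {F} \<subseteq> nbrs F"
          using that adj_iff[of F] inFam \<open>y \<notin> W\<close> by (auto simp: T_def nbrs_def)
        moreover have "card (T - {F}) \<ge> 2" using T3 F finT by simp
        ultimately have "nbrs F = T - {F}"
          using card_seteq[OF finite_nbrs, of "T - {F}" F] card_nbrs[of F] by simp
        moreover have "card (T - {F}) \<le> 2" using calculation card_nbrs[of F] by simp
        ultimately show ?thesis using T3 F finT by simp
      qed
      obtain F where F: "F \<in> T" using T3 by fastforce
      have "card C \<le> 3"
      proof (rule closed[OF F])
        show "F \<in> C" using F by (simp add: T_def)
        show "card T \<le> 3" using nb[OF F] by simp
        show "H \<in> T" if "G \<in> T" "adj G H" for G H
          using nb[OF that(1)] that(2) by (auto simp: nbrs_def)
      qed (rule finT)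
      then show False using False by simp
    qed
    \<comment> \<open>A singleton has a single neighbour \<open>g F\<close>, which is not a singleton. Two singletons with the
      same neighbour would form a component of size three with it, so \<open>g\<close> is injective.\<close>
    define S where "S = {F \<in> C. card (F - W) = 1}"
    have "\<exists>G. G \<in> C \<and> adj F G" if "F \<in> S" for F
    proof -
      have "F \<in> C" "2 \<le> card C" using that False by (simp_all add: S_def)
      then show ?thesis using class_nbr[OF C(1)] by metis
    qed
    then obtain g where g: "\<And>F. F \<in> S \<Longrightarrow> g F \<in> C \<and> adj F (g F)" by metis
    have single: "nbrs F = {g F} \<and> g F \<notin> S" if F: "F \<in> S" for F
    proof -
      from F obtain y where y: "F \<in> C" "F - W = {y}" by (auto simp: S_def card_1_singleton_iff)
      have mem: "y \<in> G" if "adj F G" for G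
      proof -
        have "(F - W) \<inter> (G - W) \<noteq> {}" using that adj_iff[of F G] by (simp add: adj_def)
        then show ?thesis unfolding y(2) by blast
      qed
      have "insert F (nbrs F) \<subseteq> {G \<in> C. y \<in> G}"
        using mem y class_closed[OF C(1) y(1)] by (auto simp: nbrs_def)
      then have "card (insert F (nbrs F)) \<le> 2"
        using deg[of y] y(2) card_mono[of "{G \<in> C. y \<in> G}" "insert F (nbrs F)"] finC by fastforce
      moreover have "F \<notin> nbrs F" by (simp add: nbrs_def adj_def)
      ultimately have "card (nbrs F) \<le> 1" using finite_nbrs by simp
      moreover have "g F \<in> nbrs F" using g[OF F] by (simp add: nbrs_def)
      ultimately have "nbrs F = {g F}"
        using finite_nbrs[of F] by (metis One_nat_def card_le_Suc0_iff_eq is_singletonI' is_singleton_def empty_iff singletonD)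
      moreover have "g F \<notin> S"
      proof
        assume "g F \<in> S"
        then obtain z where z: "g F \<in> C" "g F - W = {z}" by (auto simp: S_def card_1_singleton_iff)
        have "y \<notin> W" using y(2) by blast
        then have "y \<in> g F - W" using mem[of "g F"] g[OF F] by blast
        then have "g F - W = F - W" unfolding z(2) y(2) by simp
        then have "g F = F" using inj z y by blast
        then show False using g[OF F] by (simp add: adj_def)
      qed
      ultimately show ?thesis by blast
    qed
    have "inj_on g S"
    proof (rule inj_onI, rule ccontr)
      fix F G assume FG: "F \<in> S" "G \<in> S" "g F = g G" "F \<noteq> G"
      have nb: "nbrs (g F) = {F, G}"
        using nbrs_subset_pair[of "g F" F G] adj_sym g[OF FG(1)] g[OF FG(2)] FG by simp
      have "card {F, G, g F} \<le> 3" by (simp add: card_insert_le_m1)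
      moreover have "H \<in> {F, G, g F}" if "K \<in> {F, G, g F}" "adj K H" for K H
      proof -
        have "H \<in> nbrs K" using that by (simp add: nbrs_def)
        then show ?thesis using that(1) single[OF FG(1)] single[OF FG(2)] nb FG(3) by auto
      qed
      ultimately have "card C \<le> 3"
        using closed[of F "{F, G, g F}"] FG(1) unfolding S_def by blast
      then show False using False by simp
    qed
    moreover have "g ` S \<subseteq> C - S" using g single by blast
    ultimately have "card S \<le> card (C - S)" using card_inj_on_le finC by blast
    moreover have "card (C - S) = card C - card S" "card S \<le> card C"
      using finC by (auto simp: S_def card_Diff_subset card_mono)
    ultimately have S: "2 * card S \<le> card C" by linarith
    have "2 * card C \<le> (\<Sum>F\<in>C. card (F - W) + of_bool (F \<in> S))"
    proof -
      have "(\<Sum>F\<in>C. 2) \<le> (\<Sum>F\<in>C. card (F - W) + of_bool (F \<in> S))"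
      proof (rule sum_mono)
        fix F assume F: "F \<in> C"
        have "card (F - W) \<noteq> 0" using ne[OF F] finF[OF F] by simp
        then show "2 \<le> card (F - W) + of_bool (F \<in> S)" using F by (auto simp: S_def)
      qed
      then show ?thesis by simp
    qed
    also have "\<dots> = (\<Sum>F\<in>C. card (F - W)) + card S"
      using finC by (simp add: sum.distrib S_def Int_def)
    also have "(\<Sum>F\<in>C. card (F - W)) = (\<Sum>F\<in>C. \<Sum>y\<in>U. of_bool (y \<in> F))"
    proof (rule sum.cong[OF refl])
      fix F assume "F \<in> C"
      then have "U \<inter> {y. y \<in> F} = F - W" by (auto simp: U_def)
      then show "card (F - W) = (\<Sum>y\<in>U. of_bool (y \<in> F))" using finU by simp
    qed
    also have "\<dots> = (\<Sum>y\<in>U. \<Sum>F\<in>C. of_bool (y \<in> F))" by (rule sum.swap)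
    also have "\<dots> \<le> (\<Sum>y\<in>U. 2)"
    proof (rule sum_mono)
      fix y assume "y \<in> U"
      then have "y \<notin> W" by (auto simp: U_def)
      then show "(\<Sum>F\<in>C. of_bool (y \<in> F)) \<le> (2 :: nat)" using deg[of y] finC by (simp add: Int_def)
    qed
    finally show ?thesis using S by simp
  qed
  then show ?thesis by (simp add: U_def)
qed

text \<open>The sets of points covered by different components are disjoint outside \<open>W\<close>. The member \<open>W\<close>,
  if present, is isolated and accounts for the additional summand.\<close>
lemma core_bound:
  assumes W: "\<And>F. F \<in> Fam \<Longrightarrow> W \<subseteq> F" "finite W" "card W = l"
  shows "2 * card Fam \<le> 3 * n + 2"
proof -
  define U where "U C = (\<Union>F\<in>C. F - W)" for C :: "nat set set"
  have isolated: "C = {W}" if "C \<in> classes" "W \<in> C" for C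
  proof -
    have "\<not> adj W G" for G
    proof
      assume "adj W G"
      then have "W \<inter> G = W" "card (W \<inter> G) \<noteq> l" using W(1) by (auto simp: adj_def)
      then show False using W(3) by simp
    qed
    then show ?thesis using class_eq_closed[OF that, of "{W}"] that(2) by auto
  qed
  have "2 * card C \<le> 3 * card (U C) + (if C = {W} then 2 else 0)" if "C \<in> classes" for C
  proof (cases "W \<in> C")
    case True
    show ?thesis unfolding isolated[OF that True] by simp
  next
    case False
    show ?thesis using class_core_bound[OF W that False] unfolding U_def by linarith
  qed
  then have "2 * card Fam \<le> (\<Sum>C\<in>classes. 3 * card (U C) + (if C = {W} then 2 else 0))"
    unfolding card_Fam sum_distrib_left by (rule sum_mono)
  also have "\<dots> \<le> 3 * (\<Sum>C\<in>classes. card (U C)) + 2"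
    using finite_classes by (simp add: sum.distrib sum_distrib_left)
  also have "(\<Sum>C\<in>classes. card (U C)) = card (\<Union>C\<in>classes. U C)"
  proof (rule card_UN_disjoint[symmetric, OF finite_classes])
    show "\<forall>C\<in>classes. finite (U C)"
      unfolding U_def using class_finite class_subset member_finite by (meson finite_Diff finite_UN subsetD)
    show "\<forall>C\<in>classes. \<forall>D\<in>classes. C \<noteq> D \<longrightarrow> U C \<inter> U D = {}"
    proof (intro ballI impI, rule ccontr)
      fix C D assume CD: "C \<in> classes" "D \<in> classes" "C \<noteq> D" "U C \<inter> U D \<noteq> {}"
      then obtain F G y where FG: "F \<in> C" "G \<in> D" "y \<in> F" "y \<in> G" "y \<notin> W" unfolding U_def by blast
      have mem: "F \<in> Fam" "G \<in> Fam" using FG CD class_subset by auto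
      have "F \<noteq> G" using FG CD classes_disjoint by blast
      have "W \<subset> F \<inter> G" using W(1)[OF mem(1)] W(1)[OF mem(2)] FG by blast
      then have "l < card (F \<inter> G)" using psubset_card_mono[of "F \<inter> G" W] member_finite[OF mem(1)] W(3) by simp
      then have "adj F G" using mem \<open>F \<noteq> G\<close> by (simp add: adj_def)
      then have "G \<in> C" using class_closed[OF CD(1) FG(1)] by blast
      then show False using FG CD classes_disjoint by blast
    qed
  qed
  also have "card (\<Union>C\<in>classes. U C) \<le> n"
  proof -
    have "(\<Union>C\<in>classes. U C) \<subseteq> {1..n}" using class_subset member_subset unfolding U_def by blast
    then show ?thesis using card_mono[of "{1..n}"] by fastforce
  qed
  finally show ?thesis by simp
qed

section \<open>The bound for all intersection sizes\<close>

lemma card_Fam_le: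
  assumes "n \<ge> 5"
  shows "card Fam + 2 \<le> 2 * n"
proof -
  consider (small) F where "F \<in> Fam" "card F < l"
    | (core) F where "F \<in> Fam" "card F = l" "\<And>G. \<not> adj F G"
    | (zero) "l = 0"
    | (unit) "l > 0" "\<And>F. F \<in> Fam \<Longrightarrow> l \<le> card F" "\<And>F. F \<in> Fam \<Longrightarrow> card F = l \<Longrightarrow> \<exists>G. adj F G"
        "\<exists>c. in_kernel c \<and> total c \<noteq> 0"
    | (affine) "\<And>c. in_kernel c \<Longrightarrow> total c = 0"
    using not_le by blast
  then show ?thesis
  proof cases
    case small
    have "Fam - {F} \<subseteq> nbrs F"
    proof
      fix G assume "G \<in> Fam - {F}"
      moreover have "card (F \<inter> G) \<le> card F" using small member_finite by (simp add: card_mono)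
      ultimately show "G \<in> nbrs F" using small by (auto simp: nbrs_def adj_def)
    qed
    then have "card (Fam - {F}) \<le> 2" by (rule order.trans[OF card_mono[OF finite_nbrs] card_nbrs])
    then show ?thesis using small finite_Fam assms by (simp add: card_Diff_singleton)
  next
    case core
    have "F \<subseteq> G" if "G \<in> Fam" for G
    proof (cases "F = G")
      case False
      then have "card (F \<inter> G) = card F" using core that by (auto simp: adj_def)
      then have "F \<inter> G = F" using card_subset_eq[of F "F \<inter> G"] member_finite[OF core(1)] by blast
      then show ?thesis by blast
    qed simp
    then have "2 * card Fam \<le> 3 * n + 2"
      using core_bound[of F] core member_finite by blast
    then show ?thesis using assms by linarith
  next
    case zero
    then have "2 * card Fam \<le> 3 * n + 2" using core_bound[of "{}"] by simp
    then show ?thesis using assms by linarith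
  next
    case unit
    then obtain c where c: "in_kernel c" "total c \<noteq> 0" by blast
    define c' where "c' = (\<lambda>F. (1 / total c) * c F + 0 * c F)"
    have "in_kernel c'" "total c' = 1"
      unfolding c'_def using in_kernel_lincomb[OF c(1) c(1)] c(2) by (simp_all only: total_lincomb) simp
    then show ?thesis using card_Fam_le_of_unit_kernel unit by blast
  next
    case affine
    have "special = {}"
      using affine[OF in_kernel_restrict_class] total_restrict_class by (auto simp: special_def)
    then obtain z where z: "3 * z + z mod 2 \<le> card Fam" "card Fam \<le> n + 1 + z"
      using card_Fam_le_special by auto
    \<comment> \<open>For \<open>n = 5\<close> the parity summand is needed to exclude \<open>z = 3\<close>.\<close>
    consider "z \<le> 2" | "z = 3" | "z \<ge> 4" by linarith
    then have "z + 3 \<le> n" by cases (use z assms in auto)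
    then show ?thesis using z by linarith
  qed
qed

section \<open>Small intersection sizes\<close>

text \<open>Counting incidences with the large members: by the Cauchy-Schwarz inequality, many sets with
  a positive proportion of the points must have large intersections on average.\<close>
lemma card_large_members:
  fixes \<delta> :: real
  assumes "\<delta> > 0" "n \<ge> 1" and l: "real l \<le> \<delta>\<^sup>2 * real n / 2"
  shows "real (card {F \<in> Fam. \<delta> * real n \<le> real (card F)}) \<le> 6 / \<delta>\<^sup>2"
proof -
  define L where "L = {F \<in> Fam. \<delta> * real n \<le> real (card F)}"
  define q where "q = real (card L)"
  have L: "finite L" "L \<subseteq> Fam" using finite_Fam by (auto simp: L_def)
  define d where "d y = (\<Sum>F\<in>L. of_bool (y \<in> F) :: real)" for y
  have card_eq: "(\<Sum>y=1..n. of_bool (y \<in> F) :: real) = real (card F)" if "F \<in> Fam" for F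
  proof -
    have "{1..n} \<inter> {y. y \<in> F} = F" using member_subset[OF that] by blast
    then show ?thesis by simp
  qed
  have deg: "(\<Sum>y=1..n. d y) = (\<Sum>F\<in>L. real (card F))"
    unfolding d_def by (subst sum.swap) (intro sum.cong refl card_eq, use L in blast)
  have "q * (\<delta> * real n) \<le> (\<Sum>F\<in>L. real (card F))"
    unfolding q_def by (rule sum_bounded_below) (simp add: L_def)
  then have lower: "(q * (\<delta> * real n))\<^sup>2 \<le> (\<Sum>y=1..n. d y)\<^sup>2"
    unfolding deg using assms by (intro power_mono) (auto simp: q_def)
  have "(\<Sum>y=1..n. (d y)\<^sup>2) = (\<Sum>F\<in>L. \<Sum>G\<in>L. real (card (F \<inter> G)))"
  proof -
    have "(\<Sum>y=1..n. (d y)\<^sup>2) = (\<Sum>y=1..n. \<Sum>F\<in>L. \<Sum>G\<in>L. of_bool (y \<in> F) * of_bool (y \<in> G))"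
      unfolding d_def power2_eq_square sum_product ..
    also have "\<dots> = (\<Sum>F\<in>L. \<Sum>y=1..n. \<Sum>G\<in>L. of_bool (y \<in> F) * of_bool (y \<in> G))"
      by (rule sum.swap)
    also have "\<dots> = (\<Sum>F\<in>L. \<Sum>G\<in>L. \<Sum>y=1..n. of_bool (y \<in> F) * of_bool (y \<in> G))"
      by (intro sum.cong refl sum.swap)
    also have "\<dots> = (\<Sum>F\<in>L. \<Sum>G\<in>L. real (card (F \<inter> G)))"
    proof (intro sum.cong refl)
      fix F G assume "F \<in> L" "G \<in> L"
      then have "{1..n} \<inter> {y. y \<in> F \<inter> G} = F \<inter> G" using L member_subset by blast
      then have "(\<Sum>y=1..n. of_bool (y \<in> F \<inter> G) :: real) = real (card (F \<inter> G))" by simp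
      then show "(\<Sum>y=1..n. of_bool (y \<in> F) * of_bool (y \<in> G)) = real (card (F \<inter> G))"
        by (simp only: of_bool_conj[symmetric] Int_iff)
    qed
    finally show ?thesis .
  qed
  also have "\<dots> \<le> (\<Sum>F\<in>L. 3 * real n + q * real l)"
  proof (rule sum_mono)
    fix F assume "F \<in> L"
    then have F: "F \<in> Fam" using L by blast
    define B where "B = L \<inter> insert F (nbrs F)"
    have cardB: "real (card B) \<le> 3"
    proof -
      have "card B \<le> card (insert F (nbrs F))" unfolding B_def using finite_nbrs by (intro card_mono) auto
      also have "\<dots> \<le> 3" using card_nbrs[of F] finite_nbrs[of F] by (simp add: card_insert_if)
      finally show ?thesis by simp
    qed
    have "real (card (F \<inter> G)) \<le> real l + (if G \<in> B then real n else 0)" if "G \<in> L" for G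
    proof (cases "G \<in> B")
      case True
      have "card (F \<inter> G) \<le> card {1..n}" using member_subset[OF F] by (intro card_mono) auto
      then show ?thesis using True by simp
    next
      case False
      then show ?thesis using that F L by (auto simp: B_def nbrs_def adj_def)
    qed
    then have "(\<Sum>G\<in>L. real (card (F \<inter> G))) \<le> (\<Sum>G\<in>L. real l + (if G \<in> B then real n else 0))"
      by (rule sum_mono)
    also have "\<dots> = q * real l + real (card B) * real n"
    proof -
      have "L \<inter> B = B" by (auto simp: B_def)
      then show ?thesis using L(1) by (simp add: sum.distrib q_def sum.If_cases)
    qed
    also have "\<dots> \<le> q * real l + 3 * real n"
      using cardB by (intro add_left_mono mult_right_mono) auto
    finally show "(\<Sum>G\<in>L. real (card (F \<inter> G))) \<le> 3 * real n + q * real l" by simp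
  qed
  also have "\<dots> = q * (3 * real n + q * real l)" by (simp add: q_def)
  also have "\<dots> \<le> q * (3 * real n + q * (\<delta>\<^sup>2 * real n / 2))"
    using l by (intro mult_left_mono add_left_mono) (auto simp: q_def)
  finally have upper: "(\<Sum>y=1..n. (d y)\<^sup>2) \<le> q * (3 * real n + q * (\<delta>\<^sup>2 * real n / 2))" .
  note lower
  also have "(\<Sum>y=1..n. d y)\<^sup>2 \<le> (\<Sum>y=1..n. (d y)\<^sup>2) * real (card {1..n})"
    by (rule sum_squared_le_sum_of_squares)
  also have "\<dots> \<le> q * (3 * real n + q * (\<delta>\<^sup>2 * real n / 2)) * real n"
    using upper by (simp add: mult_right_mono)
  finally have "(q * real n) * (real n * (q * \<delta>\<^sup>2)) \<le> (q * real n) * (real n * (3 + q * \<delta>\<^sup>2 / 2))"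
    by (simp add: power2_eq_square algebra_simps)
  then have main: "(q * (real n)\<^sup>2) * (q * \<delta>\<^sup>2) \<le> (q * (real n)\<^sup>2) * (3 + q * \<delta>\<^sup>2 / 2)"
    by (simp add: power2_eq_square mult_ac)
  have "q * \<delta>\<^sup>2 \<le> 6"
  proof (cases "q = 0")
    case False
    then have "0 < q * (real n)\<^sup>2" using assms(2) by (simp add: q_def)
    then have "q * \<delta>\<^sup>2 \<le> 3 + q * \<delta>\<^sup>2 / 2" using main mult_le_cancel_left_pos by blast
    then show ?thesis by simp
  qed simp
  then show ?thesis using assms(1) unfolding q_def L_def by (simp add: pos_le_divide_eq)
qed

text \<open>Let \<open>w\<close> be the common point of the kernel vectors with coefficient sum 1. For one member from
  each component, the differences between the indicator vectors and \<open>w\<close> are pairwise orthogonal, and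
  their squared norms are the sizes of the members minus \<open>l\<close>. If there are many special components
  with only small members, Bessel's inequality yields for every point \<open>p\<close> a special component all of
  whose members are within distance less than 1/2 of \<open>w\<close> at \<open>p\<close>. These members agree at \<open>p\<close>, and
  \<open>w\<close> is an affine combination of them, so \<open>w p\<close> is 0 or 1. The set \<open>W\<close> where \<open>w\<close> is 1 has \<open>l\<close>
  elements and meets every member in \<open>l\<close> elements.\<close>
lemma core_of_many_special:
  fixes \<delta> :: real
  assumes "\<delta> > 0" "n \<ge> 1" and l: "real l \<le> \<delta>\<^sup>2 * real n / 2"
    and many: "4 * \<delta> * real n + 6 / \<delta>\<^sup>2 < real (card special)"
  obtains W where "finite W" "card W = l" "\<And>F. F \<in> Fam \<Longrightarrow> W \<subseteq> F"
proof -
  define L where "L = {F \<in> Fam. \<delta> * real n \<le> real (card F)}"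
  define Sm where "Sm = {C \<in> special. C \<inter> L = {}}"
  have finL: "finite L" using finite_Fam by (simp add: L_def)
  have cl: "C \<in> classes" if "C \<in> special" for C using that by (simp add: special_def)
  \<comment> \<open>Every other special component contains a large member, and components are disjoint.\<close>
  have "card (special - Sm) \<le> card L"
  proof -
    have "\<exists>F. F \<in> C \<inter> L" if "C \<in> special - Sm" for C using that by (auto simp: Sm_def)
    then obtain h where h: "\<And>C. C \<in> special - Sm \<Longrightarrow> h C \<in> C \<inter> L" by metis
    have "inj_on h (special - Sm)"
    proof (rule inj_onI)
      fix C D assume CD: "C \<in> special - Sm" "D \<in> special - Sm" "h C = h D"
      then have "h C \<in> C \<inter> D" using h[of C] h[of D] by simp
      then show "C = D" using classes_disjoint[of C D] cl CD by blast
    qed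
    then show ?thesis using h finL by (intro card_inj_on_le[of h]) auto
  qed
  then have "real (card (special - Sm)) \<le> 6 / \<delta>\<^sup>2"
    using card_large_members[OF assms(1-3)] unfolding L_def by linarith
  moreover have "card special = card Sm + card (special - Sm)"
  proof -
    have "Sm \<subseteq> special" by (auto simp: Sm_def)
    then show ?thesis
      using card_Diff_subset[OF finite_subset[OF _ finite_special], of Sm] card_mono[OF finite_special, of Sm]
      by simp
  qed
  ultimately have manySm: "4 * \<delta> * real n < real (card Sm)" using many by simp
  have finSm: "finite Sm" using finite_special by (simp add: Sm_def)
  have unit: "\<exists>c. in_kernel c \<and> total c = 1 \<and> (\<forall>F. F \<notin> C \<longrightarrow> c F = 0)" if CSm: "C \<in> Sm" for C
  proof -
    have C: "C \<in> classes" using CSm by (auto simp: Sm_def special_def)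
    obtain x where x: "in_kernel x" "(\<Sum>G\<in>C. x G) \<noteq> 0" using CSm by (auto simp: Sm_def special_def)
    define r where "r = restrict_class C x"
    have r: "in_kernel r" "total r \<noteq> 0"
      using in_kernel_restrict_class[OF C x(1)] total_restrict_class[OF C] x(2) by (simp_all add: r_def)
    have "total (\<lambda>F. 1 / total r * r F + 0 * r F) = 1"
      unfolding total_lincomb using r(2) by simp
    then show ?thesis using in_kernel_lincomb[OF r(1) r(1), of "1 / total r" 0]
      by (intro exI[of _ "\<lambda>F. 1 / total r * r F + 0 * r F"]) (auto simp: r_def restrict_class_def)
  qed
  have "0 \<le> 4 * \<delta> * real n" using assms by simp
  then have "Sm \<noteq> {}" using manySm by auto
  then obtain c where c: "in_kernel c" "total c = 1" using unit by blast
  define w where "w = combo c"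
  have w_member: "(\<Sum>y\<in>F. w y) = real l" if "F \<in> Fam" for F
    using in_kernelD[OF c(1) that] c(2) by (simp add: w_def)
  have w_sq: "(\<Sum>y=1..n. w y * w y) = real l" using sum_combo_sq[OF c(1), of c] c(2) by (simp add: w_def)
  define u where "u F y = of_bool (y \<in> F) - w y" for F y
  have inner: "(\<Sum>y=1..n. u F y * u G y) = dev F G" if "F \<in> Fam" "G \<in> Fam" for F G
  proof -
    have ind: "(\<Sum>y=1..n. of_bool (y \<in> F) * w y) = real l" if "F \<in> Fam" for F
    proof -
      have "(\<Sum>y=1..n. of_bool (y \<in> F) * w y) = (\<Sum>y\<in>{1..n} \<inter> {y. y \<in> F}. w y)" by simp
      also have "{1..n} \<inter> {y. y \<in> F} = F" using member_subset[OF that] by blast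
      finally show ?thesis using w_member[OF that] by simp
    qed
    have "{1..n} \<inter> {y. y \<in> F \<inter> G} = F \<inter> G" using that member_subset by blast
    then have FG: "(\<Sum>y=1..n. of_bool (y \<in> F \<inter> G) :: real) = real (card (F \<inter> G))" by simp
    have "(\<Sum>y=1..n. u F y * u G y) = (\<Sum>y=1..n. of_bool (y \<in> F \<inter> G)) - (\<Sum>y=1..n. of_bool (y \<in> F) * w y)
        - (\<Sum>y=1..n. of_bool (y \<in> G) * w y) + (\<Sum>y=1..n. w y * w y)"
      unfolding sum_subtractf[symmetric] sum.distrib[symmetric]
      by (rule sum.cong) (auto simp: u_def algebra_simps)
    then show ?thesis using FG ind[OF that(1)] ind[OF that(2)] w_sq by (simp only: dev_def)
  qed
  have w01: "w p = 0 \<or> w p = 1" if p: "p \<in> {1..n}" for p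
  proof -
    define T where "T = {C \<in> Sm. \<exists>G\<in>C. \<bar>u G p\<bar> \<ge> 1 / 2}"
    have finT: "finite T" using finSm by (simp add: T_def)
    have "\<exists>G. G \<in> C \<and> \<bar>u G p\<bar> \<ge> 1 / 2" if "C \<in> T" for C using that by (auto simp: T_def)
    then obtain g where g: "\<And>C. C \<in> T \<Longrightarrow> g C \<in> C \<and> \<bar>u (g C) p\<bar> \<ge> 1 / 2" by metis
    have gFam: "g C \<in> Fam" if "C \<in> T" for C
      using g[OF that] that cl class_subset unfolding T_def Sm_def by blast
    have "(\<Sum>C\<in>T. (u (g C) p)\<^sup>2) \<le> \<delta> * real n"
    proof (rule orthogonal_coordinate_bound[OF finT finite_atLeastAtMost p])
      show "0 \<le> \<delta> * real n" using assms by simp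
      show "(\<Sum>y=1..n. u (g C) y * u (g D) y) = 0" if "C \<in> T" "D \<in> T" "C \<noteq> D" for C D
      proof -
        have cls: "C \<in> classes" "D \<in> classes" using that cl by (auto simp: T_def Sm_def)
        have "C \<inter> D = {}" using classes_disjoint[OF cls that(3)] .
        then have "g C \<noteq> g D" "g D \<notin> C" using g[OF that(1)] g[OF that(2)] by auto
        moreover have "\<not> adj (g C) (g D)" using class_closed[OF cls(1)] g[OF that(1)] \<open>g D \<notin> C\<close> by blast
        ultimately show ?thesis using inner dev_nonadj gFam that by simp
      qed
      show "(\<Sum>y=1..n. u (g C) y * u (g C) y) \<le> \<delta> * real n" if "C \<in> T" for C
      proof -
        have "g C \<notin> L" using g[OF that] that by (auto simp: T_def Sm_def)
        then show ?thesis using inner[OF gFam gFam] gFam that by (simp add: L_def dev_def)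
      qed
    qed
    moreover have "real (card T) * (1 / 4) \<le> (\<Sum>C\<in>T. (u (g C) p)\<^sup>2)"
    proof (rule sum_bounded_below)
      fix C assume "C \<in> T"
      then have "(1 / 2)\<^sup>2 \<le> \<bar>u (g C) p\<bar>\<^sup>2" using g by (intro power_mono) auto
      then show "1 / 4 \<le> (u (g C) p)\<^sup>2" by (simp add: power2_eq_square)
    qed
    ultimately have "real (card T) < real (card Sm)" using manySm by linarith
    then have "T \<noteq> Sm" by auto
    then obtain C where C: "C \<in> Sm" "\<And>G. G \<in> C \<Longrightarrow> \<bar>u G p\<bar> < 1 / 2" unfolding T_def by fastforce
    obtain c' where c': "in_kernel c'" "total c' = 1" "\<And>F. F \<notin> C \<Longrightarrow> c' F = 0" using unit[OF C(1)] by blast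
    have wp: "w p = combo c' p" unfolding w_def by (rule combo_unique) (use c c' in auto)
    define b where "b = (of_bool (w p > 1 / 2) :: real)"
    have same: "of_bool (p \<in> G) = b" if "G \<in> C" for G
    proof -
      have "- (1 / 2) < u G p" "u G p < 1 / 2" using C(2)[OF that] by linarith+
      then show ?thesis unfolding u_def b_def by (cases "p \<in> G") simp_all
    qed
    have "combo c' p = (\<Sum>G\<in>Fam. b * c' G)"
      unfolding combo_def
    proof (rule sum.cong[OF refl])
      fix G
      show "of_bool (p \<in> G) * c' G = b * c' G" using same[of G] c'(3)[of G] by (cases "G \<in> C") simp_all
    qed
    also have "\<dots> = b * total c'" by (simp only: total_def sum_distrib_left)
    finally have "w p = b" using wp c'(2) by simp
    moreover have "b = 0 \<or> b = 1" by (simp add: b_def)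
    ultimately show ?thesis by metis
  qed
  define W where "W = {y \<in> {1..n}. w y = 1}"
  have finW: "finite W" by (simp add: W_def)
  have w_eq: "w y = of_bool (y \<in> W)" if "y \<in> {1..n}" for y using w01[OF that] that by (auto simp: W_def)
  have "real (card W) = (\<Sum>y=1..n. of_bool (y \<in> W))"
  proof -
    have "{1..n} \<inter> {y. y \<in> W} = W" by (auto simp: W_def)
    then show ?thesis by simp
  qed
  also have "\<dots> = (\<Sum>y=1..n. w y * w y)" using w_eq by (intro sum.cong refl) auto
  finally have cardW: "card W = l" using w_sq by simp
  have "W \<subseteq> F" if F: "F \<in> Fam" for F
  proof -
    have "(\<Sum>y\<in>F. w y) = (\<Sum>y\<in>F. of_bool (y \<in> W))"
      using w_eq member_subset[OF F] by (intro sum.cong refl) blast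
    also have "\<dots> = real (card (F \<inter> {y. y \<in> W}))" using member_finite[OF F] by simp
    also have "F \<inter> {y. y \<in> W} = W \<inter> F" by auto
    finally have "card (W \<inter> F) = card W" using w_member[OF F] cardW by simp
    then have "W \<inter> F = W" using card_subset_eq[OF finW] by blast
    then show ?thesis by blast
  qed
  then show ?thesis using that finW cardW by blast
qed

lemma card_Fam_le_small_lambda:
  fixes \<delta> :: real
  assumes "\<delta> > 0" "n \<ge> 1" "real l \<le> \<delta>\<^sup>2 * real n / 2"
  shows "real (card Fam) \<le> 3 / 2 * (real n + 1 + 4 * \<delta> * real n + 6 / \<delta>\<^sup>2)"
proof (cases "4 * \<delta> * real n + 6 / \<delta>\<^sup>2 < real (card special)")
  case True
  from core_of_many_special[OF assms True] obtain W
    where "finite W" "card W = l" "\<And>F. F \<in> Fam \<Longrightarrow> W \<subseteq> F" by blast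
  then have "2 * card Fam \<le> 3 * n + 2" using core_bound by blast
  then have "real (2 * card Fam) \<le> real (3 * n + 2)" by (rule of_nat_mono)
  then have "real (card Fam) \<le> 3 / 2 * (real n + 1)" by simp
  moreover have "0 \<le> 4 * \<delta> * real n + 6 / \<delta>\<^sup>2" using assms by simp
  ultimately show ?thesis by simp
next
  case False
  obtain z where "3 * z \<le> card Fam" "card Fam \<le> n + 1 + z + card special"
    using card_Fam_le_special add_leD1 by blast
  then have "real (3 * z) \<le> real (card Fam)" "real (card Fam) \<le> real (n + 1 + z + card special)"
    by (simp_all only: of_nat_le_iff)
  then have "2 * real (card Fam) \<le> 3 * (real n + 1 + real (card special))" by simp
  then show ?thesis using False by simp
qed

end

section \<open>The bounds for general k\<close>

text \<open>Each colour class of a partition into \<open>t\<close> parts of degree at most 2 is a 2-almost Fisher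
  family.\<close>
lemma max_almost_fisher_le_mult:
  assumes "k < 3 * t"
  shows "max_almost_fisher n k l \<le> t * max_almost_fisher n 2 l"
proof -
  obtain \<F> where \<F>: "almost_fisher n k l \<F>" "card \<F> = max_almost_fisher n k l"
    using max_almost_fisher_attained by blast
  have fin: "finite \<F>" using \<F>(1) unfolding almost_fisher_def
    by (meson finite_Pow_iff finite_atLeastAtMost rev_finite_subset)
  obtain c where c: "\<And>F. F \<in> \<F> \<Longrightarrow> c F < t"
    "\<And>F. F \<in> \<F> \<Longrightarrow> card {G \<in> \<F> - {F}. card (F \<inter> G) \<noteq> l \<and> c G = c F} \<le> 2"
  proof -
    have "\<exists>c. (\<forall>F\<in>\<F>. c F < t) \<and>
        (\<forall>F\<in>\<F>. card {G \<in> \<F> - {F}. card (F \<inter> G) \<noteq> l \<and> c G = c F} \<le> 2)"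
    proof (rule exists_balanced_colouring[OF fin, where R = "\<lambda>F G. card (F \<inter> G) \<noteq> l" and k = k])
      show "card {G \<in> \<F> - {F}. card (F \<inter> G) \<noteq> l} \<le> k" if "F \<in> \<F>" for F
        using \<F>(1) that by (simp add: almost_fisher_def)
    qed (use assms in \<open>simp_all add: Int_commute\<close>)
    then show ?thesis using that by blast
  qed
  have "card {F \<in> \<F>. c F = i} \<le> max_almost_fisher n 2 l" for i
  proof (rule card_le_max_almost_fisher)
    show "almost_fisher n 2 l {F \<in> \<F>. c F = i}"
      unfolding almost_fisher_def
    proof (intro conjI ballI)
      show "{F \<in> \<F>. c F = i} \<subseteq> Pow {1..n}" using \<F>(1) unfolding almost_fisher_def by blast
    next
      fix F assume F: "F \<in> {F \<in> \<F>. c F = i}"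
      then have "{G \<in> {F \<in> \<F>. c F = i} - {F}. card (F \<inter> G) \<noteq> l}
          = {G \<in> \<F> - {F}. card (F \<inter> G) \<noteq> l \<and> c G = c F}" by auto
      then show "card {G \<in> {F \<in> \<F>. c F = i} - {F}. card (F \<inter> G) \<noteq> l} \<le> 2"
        using c(2)[of F] F by simp
    qed
  qed
  then have "(\<Sum>i<t. card {F \<in> \<F>. c F = i}) \<le> (\<Sum>i<t. max_almost_fisher n 2 l)" by (rule sum_mono)
  moreover have "(\<Sum>i<t. card {F \<in> \<F>. c F = i}) = card (\<Union>i<t. {F \<in> \<F>. c F = i})"
    by (rule card_UN_disjoint[symmetric]) (auto simp: fin)
  moreover have "(\<Union>i<t. {F \<in> \<F>. c F = i}) = \<F>" using c(1) by auto
  ultimately show ?thesis using \<F>(2) by simp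
qed

lemma max_almost_fisher_2_le:
  assumes "n \<ge> 5"
  shows "max_almost_fisher n 2 l + 2 \<le> 2 * n"
proof -
  obtain \<F> where "almost_fisher n 2 l \<F>" "card \<F> = max_almost_fisher n 2 l"
    using max_almost_fisher_attained by blast
  then show ?thesis
    using two_almost_fisher.card_Fam_le[of n l \<F>] assms by (simp add: two_almost_fisher_def)
qed

lemma max_almost_fisher_2_le_small_lambda:
  fixes \<delta> :: real
  assumes "\<delta> > 0" "n \<ge> 1" "real l \<le> \<delta>\<^sup>2 * real n / 2"
  shows "real (max_almost_fisher n 2 l) \<le> 3 / 2 * (real n + 1 + 4 * \<delta> * real n + 6 / \<delta>\<^sup>2)"
proof -
  obtain \<F> where "almost_fisher n 2 l \<F>" "card \<F> = max_almost_fisher n 2 l"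
    using max_almost_fisher_attained by blast
  then show ?thesis
    using two_almost_fisher.card_Fam_le_small_lambda[of n l \<F> \<delta>] assms
    by (simp add: two_almost_fisher_def)
qed

theorem corollary1p7:
  fixes k :: nat
  assumes "k \<ge> 1"
  shows "(\<forall>n l :: nat. n \<ge> 5 \<longrightarrow>
            int (max_almost_fisher n k l) \<le> (2 * int n - 2) * \<lceil>real (k + 1) / 3\<rceil>)
       \<and> (\<forall>l :: nat \<Rightarrow> nat. (\<lambda>n. real (l n)) \<in> o(\<lambda>n. real n) \<longrightarrow>
            (\<exists>\<epsilon> :: nat \<Rightarrow> real. \<epsilon> \<in> o(\<lambda>_. 1) \<and>
              (\<forall>n\<ge>1. real (max_almost_fisher n k (l n))
                        \<le> (3 / 2 + \<epsilon> n) * real n * real_of_int \<lceil>real (k + 1) / 3\<rceil>)))"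
proof -
  define t where "t = nat \<lceil>real (k + 1) / 3\<rceil>"
  have ceil: "\<lceil>real (k + 1) / 3\<rceil> = int t" unfolding t_def by simp
  have "real (k + 1) / 3 \<le> real t" using le_of_int_ceiling[of "real (k + 1) / 3"] unfolding ceil by simp
  then have "k < 3 * t" by simp
  note parts = max_almost_fisher_le_mult[OF this]
  show ?thesis
    unfolding ceil
  proof (intro conjI allI impI)
    fix n l :: nat assume n: "n \<ge> 5"
    have "max_almost_fisher n k l \<le> t * (2 * n - 2)"
      using parts[of n l] max_almost_fisher_2_le[OF n, of l]
      by (meson Nat.le_diff_conv2 add_leD2 le_trans mult_le_mono2)
    then have "int (max_almost_fisher n k l) \<le> int (t * (2 * n - 2))" by (rule of_nat_mono)
    then show "int (max_almost_fisher n k l) \<le> (2 * int n - 2) * int t"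
      using n by (simp add: of_nat_diff mult.commute)
  next
    fix l :: "nat \<Rightarrow> nat" assume l: "(\<lambda>n. real (l n)) \<in> o(\<lambda>n. real n)"
    define M where "M n = real (max_almost_fisher n 2 (l n))" for n
    define \<epsilon> where "\<epsilon> n = max 0 (M n / real n - 3 / 2)" for n
    have "\<epsilon> \<in> o(\<lambda>_. 1)"
    proof (rule landau_o.smallI)
      fix e :: real assume e: "e > 0"
      \<comment> \<open>With this \<open>\<delta>\<close> the term \<open>3 / 2 * 4 * \<delta> * n\<close> equals half of \<open>e * n\<close>; the other half absorbs
        the constant \<open>K\<close>.\<close>
      define \<delta> where "\<delta> = e / 12"
      have \<delta>: "\<delta> > 0" using e by (simp add: \<delta>_def)
      define K where "K = 3 / 2 * (1 + 6 / \<delta>\<^sup>2)"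
      have "eventually (\<lambda>n. norm (real (l n)) \<le> (\<delta>\<^sup>2 / 2) * norm (real n)) sequentially"
        by (rule landau_o.smallD[OF l]) (use \<delta> in simp)
      moreover have "eventually (\<lambda>n. real n \<ge> max 1 (2 * K / e)) sequentially"
        using filterlim_real_sequentially unfolding filterlim_at_top by blast
      ultimately show "eventually (\<lambda>n. norm (\<epsilon> n) \<le> e * norm (1 :: real)) sequentially"
      proof eventually_elim
        case (elim n)
        then have n: "n \<ge> 1" "real n > 0" "2 * K / e \<le> real n" by auto
        have "M n \<le> 3 / 2 * (real n + 1 + 4 * \<delta> * real n + 6 / \<delta>\<^sup>2)"
          unfolding M_def
          by (rule max_almost_fisher_2_le_small_lambda[OF \<delta> n(1)]) (use elim in simp)
        also have "\<dots> = 3 / 2 * real n + e / 2 * real n + K"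
          by (simp add: K_def \<delta>_def algebra_simps)
        also have "K \<le> e / 2 * real n" using n(3) e by (simp add: field_simps)
        finally have "M n \<le> (3 / 2 + e) * real n" by (simp add: algebra_simps)
        then have "M n / real n \<le> 3 / 2 + e" using n(2) by (simp add: pos_divide_le_eq)
        then show ?case using e by (simp add: \<epsilon>_def)
      qed
    qed
    moreover have "real (max_almost_fisher n k (l n)) \<le> (3 / 2 + \<epsilon> n) * real n * real_of_int (int t)"
      if n: "n \<ge> 1" for n
    proof -
      have "M n / real n \<le> 3 / 2 + \<epsilon> n" by (simp add: \<epsilon>_def)
      then have "M n \<le> (3 / 2 + \<epsilon> n) * real n" using n by (simp add: pos_divide_le_eq)
      then have "M n * real t \<le> (3 / 2 + \<epsilon> n) * real n * real t" by (rule mult_right_mono) simp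
      moreover have "real (max_almost_fisher n k (l n)) \<le> M n * real t"
        using parts[of n "l n"] unfolding M_def by (metis mult.commute of_nat_le_iff of_nat_mult)
      ultimately show ?thesis by simp
    qed
    ultimately show "\<exists>\<epsilon> :: nat \<Rightarrow> real. \<epsilon> \<in> o(\<lambda>_. 1) \<and> (\<forall>n\<ge>1. real (max_almost_fisher n k (l n))
        \<le> (3 / 2 + \<epsilon> n) * real n * real_of_int (int t))" by blast
  qed
qed

end
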